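(* Let $g\geq 2$ and $1\leq i\leq g-1$ be integers, and let $d$ be an integer with $|d|=g-i$. Then there exist a triangulation $K$ of the closed orientable surface of genus $g$ with exactly $6g-2i+1$ vertices, an orientation of $K$, and a simplicial map $f:K\to\mathbb{T}^2$ of degree $d$, where $\mathbb{T}^2$ denotes the $7$-vertex triangulated torus with a fixed orientation.
   Context: A triangulation of a surface $M$ is a finite (abstract or geometric) simplicial complex whose geometric carrier is homeomorphic to $M$. A simplicial map $f:K\to L$ is a map of vertex sets sending the vertices of every simplex of $K$ to the vertices of a simplex of $L$ (possibly of lower dimension). The $7$-vertex triangulated torus $\mathbb{T}^2$ is the simplicial complex on vertices $v_1,\dots,v_7$ with the $14$ triangles $[v_1v_2v_4]$, $[v_2v_4v_5]$, $[v_2v_3v_5]$, $[v_3v_5v_6]$, $[v_1v_5v_6]$, $[v_1v_2v_6]$, $[v_2v_6v_7]$, $[v_2v_3v_7]$, $[v_1v_3v_7]$, $[v_1v_5v_7]$, $[v_4v_5v_7]$, $[v_4v_6v_7]$, $[v_3v_4v_6]$, $[v_1v_3v_4]$; it is oriented so that $[v_1v_2v_4]$, with vertex order $v_1<v_2<v_4$, is positively oriented. For closed connected oriented triangulated surfaces $K,L$ with fundamental classes $[a]\in H_2(K;\mathbb{Z})\cong\mathbb{Z}$ and $[b]\in H_2(L;\mathbb{Z})\cong\mathbb{Z}$, the degree of a simplicial map $f:K\to L$ is the integer $d$ with $f_*([a])=d\cdot[b]$. The orientation of the domain $K$ may be chosen freely (so reversing it changes $d$ to $-d$). *)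

theory Defs
  imports
    "HOL-Analysis.Analysis"
    "HOL-Algebra.Elementary_Groups"
    "HOL-Combinatorics.Permutations"
begin

section \<open>Closed orientable surfaces\<close>

text \<open>
  \<open>X\<close> is a connected sum of \<open>M\<close> and \<open>N\<close>: the interiors of embedded closed discs (with
  characteristic maps \<open>h\<close> and \<open>k\<close>) are removed, and \<open>X\<close> is the result of glueing the remainders
  along the boundary circles via \<open>h z \<sim> k z\<close>. As both remainders are closed subspaces of \<open>X\<close> that
  cover it, \<open>X\<close> carries the topology of the adjunction space.
\<close>

definition connected_sum :: "'a topology \<Rightarrow> 'b topology \<Rightarrow> 'c topology \<Rightarrow> bool" where
  "connected_sum M N X \<longleftrightarrow>
    (\<exists>h k p q.
      embedding_map (top_of_set (cball (0::complex) 1)) M h \<and>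
      embedding_map (top_of_set (cball (0::complex) 1)) N k \<and>
      (let A = topspace M - h ` ball 0 1; B = topspace N - k ` ball 0 1 in
        embedding_map (subtopology M A) X p \<and> closed_map (subtopology M A) X p \<and>
        embedding_map (subtopology N B) X q \<and> closed_map (subtopology N B) X q \<and>
        topspace X = p ` A \<union> q ` B \<and>
        (\<forall>x\<in>A. \<forall>y\<in>B. p x = q y \<longleftrightarrow> (\<exists>z\<in>sphere 0 1. x = h z \<and> y = k z))))"

definition standard_torus :: "(complex \<times> complex) topology" where
  "standard_torus = top_of_set (sphere 0 1 \<times> sphere 0 1)"

text \<open>
  The closed orientable surface of genus \<open>g\<close>, up to homeomorphism: the sphere for \<open>g = 0\<close>, and the
  connected sum of \<open>g\<close> tori for \<open>g \<ge> 1\<close>. No choice of orientations is needed for the sums, since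
  the torus has an orientation-reversing self-homeomorphism.
\<close>

inductive closed_orientable_surface :: "nat \<Rightarrow> 'a topology \<Rightarrow> bool" where
  sphere: "X homeomorphic_space top_of_set (sphere (0::real^3) 1)
    \<Longrightarrow> closed_orientable_surface 0 X"
| torus: "X homeomorphic_space standard_torus
    \<Longrightarrow> closed_orientable_surface 1 X"
| sum_torus: "\<lbrakk>g \<ge> 1; closed_orientable_surface g M; connected_sum M standard_torus X\<rbrakk>
    \<Longrightarrow> closed_orientable_surface (Suc g) X"


section \<open>Simplicial complexes and triangulations\<close>

definition finite_simplicial_complex :: "'v set set \<Rightarrow> bool" where
  "finite_simplicial_complex K \<longleftrightarrow>
    finite K \<and> (\<forall>\<sigma>\<in>K. finite \<sigma> \<and> \<sigma> \<noteq> {} \<and> (\<forall>\<tau>. \<tau> \<subseteq> \<sigma> \<and> \<tau> \<noteq> {} \<longrightarrow> \<tau> \<in> K))"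

abbreviation vertices :: "'v set set \<Rightarrow> 'v set" where
  "vertices K \<equiv> \<Union>K"

definition simplicial_map :: "'v set set \<Rightarrow> 'w set set \<Rightarrow> ('v \<Rightarrow> 'w) \<Rightarrow> bool" where
  "simplicial_map K L f \<longleftrightarrow> (\<forall>\<sigma>\<in>K. f ` \<sigma> \<in> L)"

text \<open>
  Points of the geometric carrier are given by their barycentric coordinates. It carries the
  subspace topology of the product topology on \<open>'v \<Rightarrow> real\<close>; for finite complexes this is the usual
  topology.
\<close>

definition geometric_carrier :: "'v set set \<Rightarrow> ('v \<Rightarrow> real) set" where
  "geometric_carrier K =
    {x. (\<forall>v. x v \<ge> 0) \<and> {v. x v \<noteq> 0} \<in> K \<and> (\<Sum>v | x v \<noteq> 0. x v) = 1}"

definition triangulates :: "'v set set \<Rightarrow> 'a topology \<Rightarrow> bool" where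
  "triangulates K M \<longleftrightarrow>
    finite_simplicial_complex K \<and> top_of_set (geometric_carrier K) homeomorphic_space M"


section \<open>Oriented simplicial homology\<close>

definition ordered_simplices :: "nat \<Rightarrow> 'v set set \<Rightarrow> 'v list set" where
  "ordered_simplices n K = {s. length s = Suc n \<and> distinct s \<and> set s \<in> K}"

text \<open>
  An oriented \<open>n\<close>-chain of a finite complex is represented by its coefficient function, \<open>c s\<close> being
  the coefficient of the oriented simplex \<open>[v\<^sub>0, \<dots>, v\<^sub>n]\<close> given by the list \<open>s\<close>. As an odd permutation
  of the vertices reverses the orientation, \<open>c\<close> is alternating.
\<close>

definition chains :: "nat \<Rightarrow> 'v set set \<Rightarrow> ('v list \<Rightarrow> int) set" where
  "chains n K =
    {c. (\<forall>s. s \<notin> ordered_simplices n K \<longrightarrow> c s = 0) \<and>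
        (\<forall>s \<pi>. \<pi> permutes {..<length s} \<longrightarrow> c (permute_list \<pi> s) = sign \<pi> * c s)}"

text \<open>
  This is \<open>\<partial>[v\<^sub>0, \<dots>, v\<^sub>n] = (\<Sum>i\<le>n. (- 1) ^ i [v\<^sub>0, \<dots>, v\<^sub>i\<^sub>-\<^sub>1, v\<^sub>i\<^sub>+\<^sub>1, \<dots>, v\<^sub>n])\<close> read off coefficientwise:
  up to the sign \<open>(- 1) ^ i\<close>, the vertex \<open>v\<^sub>i\<close> may be moved to the front.
\<close>

definition boundary :: "nat \<Rightarrow> 'v set set \<Rightarrow> ('v list \<Rightarrow> int) \<Rightarrow> ('v list \<Rightarrow> int)" where
  "boundary n K c = (\<lambda>s. if n = 0 then 0 else (\<Sum>v\<in>vertices K. c (v # s)))"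

definition cycle_group :: "nat \<Rightarrow> 'v set set \<Rightarrow> ('v list \<Rightarrow> int) monoid" where
  "cycle_group n K =
    \<lparr>carrier = {c \<in> chains n K. boundary n K c = (\<lambda>s. 0)},
     monoid.mult = (\<lambda>c c' s. c s + c' s), one = (\<lambda>s. 0)\<rparr>"

definition boundaries :: "nat \<Rightarrow> 'v set set \<Rightarrow> ('v list \<Rightarrow> int) set" where
  "boundaries n K = boundary (Suc n) K ` chains (Suc n) K"

definition simplicial_homology :: "nat \<Rightarrow> 'v set set \<Rightarrow> ('v list \<Rightarrow> int) set monoid" where
  "simplicial_homology n K = cycle_group n K Mod boundaries n K"

text \<open>
  \<open>f\<^sub>#[v\<^sub>0, \<dots>, v\<^sub>n]\<close> is \<open>[f v\<^sub>0, \<dots>, f v\<^sub>n]\<close>, or \<open>0\<close> if these vertices are not distinct.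
\<close>

definition chain_map ::
    "nat \<Rightarrow> 'v set set \<Rightarrow> ('v \<Rightarrow> 'w) \<Rightarrow> ('v list \<Rightarrow> int) \<Rightarrow> ('w list \<Rightarrow> int)" where
  "chain_map n K f c =
    (\<lambda>s. if distinct s then \<Sum>t | t \<in> ordered_simplices n K \<and> map f t = s. c t else 0)"

text \<open>
  For a simplicial map, all representatives \<open>c\<close> of the class \<open>\<alpha>\<close> contribute the same coset to the
  union.
\<close>

definition hom_induced_simplicial ::
    "nat \<Rightarrow> 'v set set \<Rightarrow> 'w set set \<Rightarrow> ('v \<Rightarrow> 'w) \<Rightarrow> ('v list \<Rightarrow> int) set \<Rightarrow> ('w list \<Rightarrow> int) set"
  where
  "hom_induced_simplicial n K L f \<alpha> =
    (\<Union>c\<in>\<alpha>. boundaries n L #>\<^bsub>cycle_group n L\<^esub> chain_map n K f c)"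


section \<open>Orientations and degree\<close>

text \<open>
  An orientation of a closed connected orientable triangulated surface \<open>K\<close> is the choice of a
  fundamental class, i.e. of a generator of the infinite cyclic group \<open>H\<^sub>2(K; \<int>)\<close>.
\<close>

definition fundamental_class :: "'v set set \<Rightarrow> ('v list \<Rightarrow> int) set \<Rightarrow> bool" where
  "fundamental_class K \<alpha> \<longleftrightarrow>
    \<alpha> \<in> carrier (simplicial_homology 2 K) \<and>
    (\<lambda>m::int. \<alpha> [^]\<^bsub>simplicial_homology 2 K\<^esub> m) \<in> iso integer_group (simplicial_homology 2 K)"

definition positively_oriented :: "('v list \<Rightarrow> int) set \<Rightarrow> 'v list \<Rightarrow> bool" where
  "positively_oriented \<alpha> s \<longleftrightarrow> (\<exists>c\<in>\<alpha>. c s = 1)"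

definition has_degree ::
    "'v set set \<Rightarrow> ('v list \<Rightarrow> int) set \<Rightarrow> 'w set set \<Rightarrow> ('w list \<Rightarrow> int) set
      \<Rightarrow> ('v \<Rightarrow> 'w) \<Rightarrow> int \<Rightarrow> bool" where
  "has_degree K \<alpha> L \<beta> f d \<longleftrightarrow>
    fundamental_class K \<alpha> \<and> fundamental_class L \<beta> \<and> simplicial_map K L f \<and>
    hom_induced_simplicial 2 K L f \<alpha> = \<beta> [^]\<^bsub>simplicial_homology 2 L\<^esub> d"


section \<open>The 7-vertex torus\<close>

definition torus7_triangles :: "nat set set" where
  "torus7_triangles =
    {{1,2,4}, {2,4,5}, {2,3,5}, {3,5,6}, {1,5,6}, {1,2,6}, {2,6,7},
     {2,3,7}, {1,3,7}, {1,5,7}, {4,5,7}, {4,6,7}, {3,4,6}, {1,3,4}}"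

definition torus7 :: "nat set set" where
  "torus7 = {\<sigma>. \<sigma> \<noteq> {} \<and> (\<exists>\<tau>\<in>torus7_triangles. \<sigma> \<subseteq> \<tau>)}"

definition torus7_class :: "(nat list \<Rightarrow> int) set" where
  "torus7_class = (THE \<beta>. fundamental_class torus7 \<beta> \<and> positively_oriented \<beta> [1, 2, 4])"

end

theory Submission
  imports Defs
begin

text \<open>
  Write \<open>k = g - i\<close>, so that \<open>k \<ge> 1\<close> and the number of vertices is \<open>(2k + 5) + 4k + 4(i - 1)\<close>. The surface
  is built from one torus with \<open>2k + 5\<close> vertices by attaching \<open>k + (i - 1)\<close> further tori with 7
  vertices. Attaching means forming the connected sum along a triangle, whose three vertices are
  shared; so each attached torus raises the genus by 1 and the number of vertices by 4.

  A fundamental cycle of the sum is the sum of fundamental cycles that cancel on the triangle, hence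
  degrees add. A torus mapped into a single simplex has degree 0, and a copy of the target mapped
  by the identity has degree 1. The obstacle to attaching many copies of the target is the sign: as
  the cycles cancel on the common triangle, that triangle must be mapped to the target with reversed
  orientation by the surface to which the copy is attached. The first torus supplies such
  triangles: it is folded onto one triangle of the target (so it contributes degree 0), and with
  \<open>2k + 5\<close> vertices it can be folded so that \<open>k\<close> of its triangles are mapped with reversed orientation
  (lemma \<open>folded_torus\<close>). A copy of the target is attached to each of these, which gives degree \<open>k\<close>
  (\<open>attach_torus_degree_one\<close>), and the remaining \<open>i - 1\<close> tori are mapped into single simplices
  (\<open>attach_torus_degree_zero\<close>). The orientation of the surface fixes the sign of \<open>d\<close>.

  All tori used are quotients of the triangular grid in the plane by a lattice of index \<open>n \<ge> 7\<close>; their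
  vertices are labelled by the integers modulo \<open>n\<close>, and the 7-vertex torus is the case \<open>n = 7\<close>. The
  quotient map gives both the homeomorphism with \<open>S\<^sup>1 \<times> S\<^sup>1\<close> (\<open>carrier_torus_homeomorphic\<close>) and, from the cyclic
  order of the six neighbours of a vertex, the fundamental cycle (\<open>surface_complex_torus\<close>).

  That the sum of the cycles generates the cycles of the connected sum is \<open>glued_cycle_multiple\<close>.
  Topologically the gluing is simple because barycentric coordinates are functions on
  the set of all vertices: the carrier of the glued complex is literally the union of the two punctured
  carriers (\<open>connected_sum_glued\<close>).
\<close>

section \<open>Two-dimensional cycles and fundamental classes\<close>

text \<open>
  Two adjacent transpositions generate the permutations of three letters, so being alternating is a
  condition on these two only.
\<close>

lemma chains_two_iff:
  "c \<in> chains 2 K \<longleftrightarrow>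
    (\<forall>s. c s \<noteq> 0 \<longrightarrow> length s = 3 \<and> distinct s \<and> set s \<in> K) \<and>
    (\<forall>x y z. c [y,x,z] = - c [x,y,z] \<and> c [x,z,y] = - c [x,y,z])"
  (is "_ \<longleftrightarrow> ?S \<and> ?A")
proof -
  have supp: "(\<forall>s. s \<notin> ordered_simplices 2 K \<longrightarrow> c s = 0) \<longleftrightarrow> ?S"
    unfolding ordered_simplices_def by (auto simp: numeral_3_eq_3 numeral_2_eq_2)
  have alt: "c (permute_list \<pi> s) = sign \<pi> * c s" if S: ?S and A: ?A and \<pi>: "\<pi> permutes {..<length s}" for \<pi> s
  proof (cases "length s = 3")
    case False
    then show ?thesis using S length_permute_list[of \<pi> s] by (metis mult_zero_right)
  next
    case True
    have "\<forall>s. length s = 3 \<longrightarrow> c (permute_list \<pi> s) = sign \<pi> * c s"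
      using \<pi>[unfolded True] finite_lessThan
    proof (induction \<pi> rule: permutes_induct)
      case id
      then show ?case by simp
    next
      case (swap a b p)
      show ?case
      proof (intro allI impI)
        fix s :: "'a list"
        assume s: "length s = 3"
        then obtain x y z where xyz: "s = [x,y,z]"
          by (auto simp: numeral_3_eq_3 length_Suc_conv)
        have swaps: "c [y,x,z] = - c [x,y,z]" "c [x,z,y] = - c [x,y,z]" "c [z,y,x] = - c [x,y,z]"
          using A by metis+
        have ab: "a = 0 \<or> a = 1 \<or> a = 2" "b = 0 \<or> b = 1 \<or> b = 2" using swap.hyps by auto
        have "c (permute_list (Transposition.transpose a b) s) = - c s"
          using ab \<open>a \<noteq> b\<close>
          by (elim disjE) (simp_all add: xyz permute_list_def Transposition.transpose_def swaps)
        moreover have "permute_list (Transposition.transpose a b \<circ> p) s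
            = permute_list p (permute_list (Transposition.transpose a b) s)"
          using swap.hyps s by (intro permute_list_compose) simp
        moreover have "sign (Transposition.transpose a b \<circ> p) = - sign p"
        proof -
          have "permutation p" using swap.hyps by (intro permutes_imp_permutation[of "{..<3}"]) simp_all
          then show ?thesis using \<open>a \<noteq> b\<close>
            by (simp add: sign_compose permutation_swap_id sign_swap_id)
        qed
        ultimately show "c (permute_list (Transposition.transpose a b \<circ> p) s)
            = sign (Transposition.transpose a b \<circ> p) * c s"
          using swap.IH s by simp
      qed
    qed
    then show ?thesis using True by blast
  qed
  have "?A" if *: "\<forall>s \<pi>. \<pi> permutes {..<length s} \<longrightarrow> c (permute_list \<pi> s) = sign \<pi> * c s"
  proof (intro allI conjI)
    fix x y z :: 'a
    have "Transposition.transpose 0 1 permutes {..<length [x,y,z]}"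
      by (rule permutes_swap_id) simp_all
    with * have "c (permute_list (Transposition.transpose 0 1) [x,y,z])
        = sign (Transposition.transpose 0 1 :: nat \<Rightarrow> nat) * c [x,y,z]" by blast
    then show "c [y,x,z] = - c [x,y,z]"
      by (simp add: permute_list_def Transposition.transpose_def sign_swap_id)
    have "Transposition.transpose 1 2 permutes {..<length [x,y,z]}"
      by (rule permutes_swap_id) simp_all
    with * have "c (permute_list (Transposition.transpose 1 2) [x,y,z])
        = sign (Transposition.transpose 1 2 :: nat \<Rightarrow> nat) * c [x,y,z]" by blast
    then show "c [x,z,y] = - c [x,y,z]"
      by (simp add: permute_list_def Transposition.transpose_def sign_swap_id)
  qed
  then show ?thesis
    using supp alt unfolding chains_def by blast
qed

definition two_cycles :: "'v set set \<Rightarrow> ('v list \<Rightarrow> int) set" where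
  "two_cycles K = {c \<in> chains 2 K. \<forall>s. (\<Sum>v\<in>vertices K. c (v # s)) = 0}"

lemma carrier_cycle_group_two: "carrier (cycle_group 2 K) = two_cycles K"
  by (auto simp: cycle_group_def two_cycles_def boundary_def fun_eq_iff)

lemma two_cycles_alternating:
  assumes "c \<in> two_cycles K"
  shows "c [x,y,z] = - c [y,x,z]" and "c [x,y,z] = - c [x,z,y]" and "c [x,y,z] = c [y,z,x]"
    and "c [x,y,z] = c [z,x,y]" and "c [x,y,z] = - c [z,y,x]"
proof -
  have A: "\<forall>x y z. c [y,x,z] = - c [x,y,z] \<and> c [x,z,y] = - c [x,y,z]"
    using assms unfolding two_cycles_def chains_two_iff by blast
  have 1: "c [x,y,z] = - c [y,x,z]" for x y z using A by blast
  have 2: "c [x,y,z] = - c [x,z,y]" for x y z using A by blast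
  show "c [x,y,z] = - c [y,x,z]" "c [x,y,z] = - c [x,z,y]" "c [x,y,z] = c [y,z,x]"
    "c [x,y,z] = c [z,x,y]" "c [x,y,z] = - c [z,y,x]"
    using 1[of x y z] 2[of x y z] 2[of y x z] 1[of z x y] 2[of z x y] by linarith+
qed

lemma two_cycles_support:
  assumes "c \<in> two_cycles K" and "c s \<noteq> 0"
  shows "length s = 3" "distinct s" "set s \<in> K"
  using assms unfolding two_cycles_def chains_two_iff by blast+

text \<open>
  In a glued complex the boundary sums run over more vertices than those of the part in which the cycle
  lives.
\<close>

lemma two_cycles_boundary:
  assumes "c \<in> two_cycles K" and "finite A" and "vertices K \<subseteq> A"
  shows "(\<Sum>v\<in>A. c (v # s)) = 0"
proof -
  have "(\<Sum>v\<in>A. c (v # s)) = (\<Sum>v\<in>vertices K. c (v # s))"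
    using assms(2,3) two_cycles_support(3)[OF assms(1)]
    by (intro sum.mono_neutral_right) (auto, metis list.set_intros(1))
  then show ?thesis using assms(1) by (simp add: two_cycles_def)
qed

lemma two_cyclesI:
  assumes "\<And>s. c s \<noteq> 0 \<Longrightarrow> length s = 3 \<and> distinct s \<and> set s \<in> K"
    and "\<And>x y z. c [y,x,z] = - c [x,y,z]" and "\<And>x y z. c [x,z,y] = - c [x,y,z]"
    and "\<And>s. (\<Sum>v\<in>vertices K. c (v # s)) = 0"
  shows "c \<in> two_cycles K"
  using assms unfolding two_cycles_def chains_two_iff by blast

lemma two_cycles_scale:
  assumes "c \<in> two_cycles K"
  shows "(\<lambda>s. (m::int) * c s) \<in> two_cycles K"
proof (rule two_cyclesI)
  show "length s = 3 \<and> distinct s \<and> set s \<in> K" if "m * c s \<noteq> 0" for s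
    using two_cycles_support[OF assms, of s] that by auto
  show "m * c [y,x,z] = - (m * c [x,y,z])" "m * c [x,z,y] = - (m * c [x,y,z])" for x y z
    by (simp_all add: two_cycles_alternating(1)[OF assms, of y x z]
      two_cycles_alternating(2)[OF assms, of x z y])
  show "(\<Sum>v\<in>vertices K. m * c (v # s)) = 0" for s
    using assms by (simp add: two_cycles_def flip: sum_distrib_left)
qed

lemma two_cycles_add:
  assumes "c \<in> two_cycles K" "c' \<in> two_cycles K"
  shows "(\<lambda>s. c s + c' s) \<in> two_cycles K"
proof (rule two_cyclesI)
  show "length s = 3 \<and> distinct s \<and> set s \<in> K" if "c s + c' s \<noteq> 0" for s
  proof -
    show ?thesis
      using that two_cycles_support[OF assms(1), of s] two_cycles_support[OF assms(2), of s]
      by (cases "c s = 0") simp_all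
  qed
  show "c [y,x,z] + c' [y,x,z] = - (c [x,y,z] + c' [x,y,z])" "c [x,z,y] + c' [x,z,y] = - (c [x,y,z] + c' [x,y,z])" for x y z
    by (simp_all add: two_cycles_alternating(1)[OF assms(1), of y x z] two_cycles_alternating(1)[OF assms(2), of y x z]
      two_cycles_alternating(2)[OF assms(1), of x z y] two_cycles_alternating(2)[OF assms(2), of x z y])
  show "(\<Sum>v\<in>vertices K. c (v # s) + c' (v # s)) = 0" for s
    using assms by (simp add: two_cycles_def sum.distrib)
qed

lemma cycle_group_mult: "c \<otimes>\<^bsub>cycle_group n K\<^esub> c' = (\<lambda>s. c s + c' s)"
  and cycle_group_one: "\<one>\<^bsub>cycle_group n K\<^esub> = (\<lambda>s. 0)"
  by (simp_all add: cycle_group_def)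

lemma zero_in_two_cycles: "(\<lambda>s. 0) \<in> two_cycles K"
  by (rule two_cyclesI) simp_all

lemma comm_group_cycle_group_two: "comm_group (cycle_group 2 K)"
proof (rule comm_groupI, unfold carrier_cycle_group_two cycle_group_mult cycle_group_one)
  fix c assume "c \<in> two_cycles K"
  from two_cycles_scale[OF this, of "-1"]
  show "\<exists>y\<in>two_cycles K. (\<lambda>s. y s + c s) = (\<lambda>s. 0)"
    by (rule bexI[rotated]) simp
qed (simp_all add: zero_in_two_cycles two_cycles_add add.assoc, simp add: add.commute)

lemma cycle_group_two_int_pow:
  assumes "c \<in> two_cycles K"
  shows "c [^]\<^bsub>cycle_group 2 K\<^esub> (m::int) = (\<lambda>s. m * c s)"
proof -
  interpret G: comm_group "cycle_group 2 K" by (rule comm_group_cycle_group_two)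
  have "(\<lambda>m s. m * c s) \<in> hom integer_group (cycle_group 2 K)"
    using two_cycles_scale[OF assms]
    by (intro homI) (simp_all add: carrier_cycle_group_two cycle_group_mult distrib_right)
  from hom_int_pow[OF this _ group_integer_group G.is_group, of 1 m] show ?thesis by simp
qed

text \<open>
  There are no chains of dimension 3, so homology classes in dimension 2 are cosets of the trivial
  group, that is, singletons of cycles.
\<close>

lemma boundaries_two_trivial:
  assumes "\<forall>\<sigma>\<in>K. card \<sigma> \<le> 3"
  shows "boundaries 2 K = {\<one>\<^bsub>cycle_group 2 K\<^esub>}"
proof -
  have "ordered_simplices 3 K = {}"
    using assms by (force simp: ordered_simplices_def dest: distinct_card)
  then have "chains 3 K = {\<lambda>s. 0}" by (auto simp: chains_def)
  then show ?thesis
    by (simp add: boundaries_def boundary_def cycle_group_def)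
qed

lemma simplicial_homology_two:
  assumes "\<forall>\<sigma>\<in>K. card \<sigma> \<le> 3"
  shows carrier_simplicial_homology_two: "carrier (simplicial_homology 2 K) = (\<lambda>c. {c}) ` two_cycles K" (is ?c)
    and simplicial_homology_two_int_pow:
      "\<And>c m. c \<in> two_cycles K \<Longrightarrow> {c} [^]\<^bsub>simplicial_homology 2 K\<^esub> (m::int) = {\<lambda>s. m * c s}"
    and group_simplicial_homology_two: "group (simplicial_homology 2 K)"
proof -
  interpret G: comm_group "cycle_group 2 K" by (rule comm_group_cycle_group_two)
  interpret N: normal "{\<one>\<^bsub>cycle_group 2 K\<^esub>}" "cycle_group 2 K"
    by (rule G.one_is_normal)
  have coset: "{\<one>\<^bsub>cycle_group 2 K\<^esub>} #>\<^bsub>cycle_group 2 K\<^esub> c = {c}" if "c \<in> two_cycles K" for c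
    using that by (simp add: r_coset_def carrier_cycle_group_two)
  show ?c
    using coset by (auto simp: simplicial_homology_def boundaries_two_trivial[OF assms] FactGroup_def
        RCOSETS_def carrier_cycle_group_two)
  show "{c} [^]\<^bsub>simplicial_homology 2 K\<^esub> (m::int) = {\<lambda>s. m * c s}" if "c \<in> two_cycles K" for c m
    using N.FactGroup_int_pow[of c m] that coset[OF that] coset[OF two_cycles_scale[OF that]]
    by (simp add: simplicial_homology_def boundaries_two_trivial[OF assms] carrier_cycle_group_two
        cycle_group_two_int_pow)
  show "group (simplicial_homology 2 K)"
    by (simp add: simplicial_homology_def boundaries_two_trivial[OF assms] N.factorgroup_is_group)
qed

text \<open>
  The coefficients \<open>\<plusminus>1\<close> are part of the notion because two such cycles have to be made to cancel on a
  common triangle.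
\<close>

definition fundamental_cycle :: "'v set set \<Rightarrow> ('v list \<Rightarrow> int) \<Rightarrow> bool" where
  "fundamental_cycle K c \<longleftrightarrow>
    c \<in> two_cycles K \<and> (\<forall>z\<in>two_cycles K. \<exists>m::int. z = (\<lambda>s. m * c s)) \<and>
    (\<exists>s. c s \<noteq> 0) \<and> (\<forall>s\<in>ordered_simplices 2 K. \<bar>c s\<bar> = 1)"

lemma fundamental_class_if_generator:
  assumes dim: "\<forall>\<sigma>\<in>K. card \<sigma> \<le> 3"
    and c: "c \<in> two_cycles K" and gen: "\<And>z. z \<in> two_cycles K \<Longrightarrow> \<exists>m::int. z = (\<lambda>s. m * c s)"
    and nz: "\<exists>s. c s \<noteq> 0"
  shows "fundamental_class K {c}"
proof -
  note H = simplicial_homology_two[OF dim]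
  interpret H: group "simplicial_homology 2 K" by (rule H(3))
  have "(\<lambda>m::int. {c} [^]\<^bsub>simplicial_homology 2 K\<^esub> m) \<in> hom integer_group (simplicial_homology 2 K)"
    using c by (intro H.hom_integer_group_pow) (simp add: H(1))
  moreover have "bij_betw (\<lambda>m::int. {c} [^]\<^bsub>simplicial_homology 2 K\<^esub> m) UNIV (carrier (simplicial_homology 2 K))"
    unfolding bij_betw_def
  proof
    show "inj (\<lambda>m::int. {c} [^]\<^bsub>simplicial_homology 2 K\<^esub> m)"
      using nz by (auto simp: inj_def H(2)[OF c] fun_eq_iff)
    show "range (\<lambda>m::int. {c} [^]\<^bsub>simplicial_homology 2 K\<^esub> m) = carrier (simplicial_homology 2 K)"
      using gen two_cycles_scale[OF c] by (auto simp: H(1) H(2)[OF c] image_iff)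
  qed
  ultimately show ?thesis
    using c by (simp add: fundamental_class_def iso_def H(1))
qed

lemma fundamental_class_generatorE:
  assumes dim: "\<forall>\<sigma>\<in>K. card \<sigma> \<le> 3" and "fundamental_class K \<alpha>"
  obtains c where "\<alpha> = {c}" "c \<in> two_cycles K" "\<And>z. z \<in> two_cycles K \<Longrightarrow> \<exists>m::int. z = (\<lambda>s. m * c s)"
proof -
  note H = simplicial_homology_two[OF dim]
  obtain c where c: "\<alpha> = {c}" "c \<in> two_cycles K"
    using assms(2) by (auto simp: fundamental_class_def H(1))
  have range: "range (\<lambda>m::int. \<alpha> [^]\<^bsub>simplicial_homology 2 K\<^esub> m) = carrier (simplicial_homology 2 K)"
    using assms(2) by (simp add: fundamental_class_def iso_def bij_betw_def)
  have "\<exists>m::int. z = (\<lambda>s. m * c s)" if "z \<in> two_cycles K" for z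
  proof -
    have "{z} \<in> range (\<lambda>m::int. \<alpha> [^]\<^bsub>simplicial_homology 2 K\<^esub> m)"
      unfolding range H(1) using that by blast
    then obtain m :: int where "{z} = \<alpha> [^]\<^bsub>simplicial_homology 2 K\<^esub> m" by blast
    then have "z = (\<lambda>s. m * c s)" by (simp add: c(1) H(2)[OF c(2)])
    then show ?thesis by blast
  qed
  then show ?thesis using c that by blast
qed

lemma has_degree_singleton:
  assumes dimK: "\<forall>\<sigma>\<in>K. card \<sigma> \<le> 3" and dimL: "\<forall>\<sigma>\<in>L. card \<sigma> \<le> 3"
    and "fundamental_class K {c}" and "fundamental_class L {b}" and "simplicial_map K L f"
    and b: "b \<in> two_cycles L" and push: "chain_map 2 K f c = (\<lambda>s. d * b s)"
  shows "has_degree K {c} L {b} f d"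
proof -
  have "boundaries 2 L #>\<^bsub>cycle_group 2 L\<^esub> chain_map 2 K f c = {\<lambda>s. d * b s}"
    by (simp add: boundaries_two_trivial[OF dimL] r_coset_def push cycle_group_mult cycle_group_one)
  then show ?thesis
    using assms simplicial_homology_two_int_pow[OF dimL b]
    by (simp add: has_degree_def hom_induced_simplicial_def)
qed

section \<open>Gluing along a triangle: the fundamental cycle\<close>

text \<open>
  A chain with boundary on the rim of \<open>\<sigma>\<close> can be closed up by a multiple of \<open>\<sigma>\<close>: the boundary is itself a
  1-cycle on a triangle, hence has the same coefficient on the three edges. The closed chain is a
  multiple of the fundamental cycle, and comparing coefficients at \<open>\<sigma>\<close> identifies the factor.
\<close>

lemma relative_cycle_multiple:
  fixes z c :: "'v list \<Rightarrow> int"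
  assumes fin: "finite (vertices K)" and fc: "fundamental_cycle K c"
    and \<sigma>: "\<sigma> = {x,y,w}" "distinct [x,y,w]" "\<sigma> \<in> K"
    and supp: "\<And>s. z s \<noteq> 0 \<Longrightarrow> length s = 3 \<and> distinct s \<and> set s \<in> K \<and> set s \<noteq> \<sigma>"
    and alt1: "\<And>p q r. z [q,p,r] = - z [p,q,r]" and alt2: "\<And>p q r. z [p,r,q] = - z [p,q,r]"
    and bd: "\<And>u v. (\<Sum>p\<in>vertices K. z [p,u,v]) \<noteq> 0 \<Longrightarrow> {u,v} \<subseteq> \<sigma>"
  obtains m :: int where "\<And>s. set s \<noteq> \<sigma> \<Longrightarrow> z s = m * c s"
    and "(\<Sum>p\<in>vertices K. z [p,x,y]) = - m * c [x,y,w]"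
proof -
  have c: "c \<in> two_cycles K" using fc by (simp add: fundamental_cycle_def)
  note alt = two_cycles_alternating[OF c]
  \<comment> \<open>The boundary of \<open>z\<close>; below, its own boundary vanishes because \<open>z\<close> is alternating.\<close>
  define \<beta> where "\<beta> u v = (\<Sum>p\<in>vertices K. z [p,u,v])" for u v
  have \<beta>_anti: "\<beta> v u = - \<beta> u v" for u v
    unfolding \<beta>_def sum_negf[symmetric] by (rule sum.cong[OF refl]) (rule alt2)
  have \<beta>_refl: "\<beta> u u = 0" for u using \<beta>_anti[of u u] by simp
  have \<beta>_supp: "\<beta> u v = 0" if "\<not> {u,v} \<subseteq> \<sigma>" for u v using bd that unfolding \<beta>_def by blast
  have \<sigma>V: "\<sigma> \<subseteq> vertices K" using \<sigma>(3) by blast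
  have \<beta>_sum: "\<beta> x v + \<beta> y v + \<beta> w v = 0" for v
  proof -
    have "(\<Sum>u\<in>vertices K. \<beta> u v) = (\<Sum>p\<in>vertices K. \<Sum>u\<in>vertices K. z [p,u,v])"
      unfolding \<beta>_def by (rule sum.swap)
    also have "\<dots> = (\<Sum>p\<in>vertices K. \<Sum>u\<in>vertices K. - z [u,p,v])"
      by (intro sum.cong refl) (rule alt1)
    also have "\<dots> = - (\<Sum>p\<in>vertices K. \<beta> p v)"
      by (simp add: \<beta>_def sum_negf)
    finally have "(\<Sum>u\<in>vertices K. \<beta> u v) = 0" by simp
    moreover have "(\<Sum>u\<in>vertices K. \<beta> u v) = (\<Sum>u\<in>\<sigma>. \<beta> u v)"
      using fin \<sigma>V \<beta>_supp by (intro sum.mono_neutral_right) auto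
    moreover have "(\<Sum>u\<in>\<sigma>. \<beta> u v) = \<beta> x v + \<beta> y v + \<beta> w v"
      using \<sigma>(1,2) by simp
    ultimately show ?thesis by simp
  qed
  define t where "t = \<beta> x y"
  have \<beta>_cyc: "\<beta> y w = t" "\<beta> w x = t"
    using \<beta>_sum[of y] \<beta>_sum[of x] \<beta>_refl[of x] \<beta>_refl[of y] \<beta>_anti[of y w] \<beta>_anti[of y x]
    by (simp_all add: t_def)
  define \<epsilon> where "\<epsilon> = c [x,y,w]"
  have "[x,y,w] \<in> ordered_simplices 2 K"
    using \<sigma> by (simp add: ordered_simplices_def)
  then have \<epsilon>1: "\<bar>\<epsilon>\<bar> = 1" using fc by (simp add: fundamental_cycle_def \<epsilon>_def)
  then have \<epsilon>2: "\<epsilon> * \<epsilon> = 1" by (metis abs_mult_self_eq mult_1)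
  define m where "m = - t * \<epsilon>"
  have m\<epsilon>: "m * \<epsilon> = - t" by (simp add: m_def mult.assoc \<epsilon>2)
  \<comment> \<open>The chain \<open>z\<close> closed up by the multiple of \<open>\<sigma>\<close> that cancels the coefficient \<open>t\<close> on its edges.\<close>
  define z' where "z' s = z s + (if set s = \<sigma> then m * c s else 0)" for s
  have alt1': "z' [q,p,r] = - z' [p,q,r]" and alt2': "z' [p,r,q] = - z' [p,q,r]" for p q r
  proof -
    have perm: "set [q,p,r] = set [p,q,r]" "set [p,r,q] = set [p,q,r]" by auto
    show "z' [q,p,r] = - z' [p,q,r]"
      unfolding z'_def perm(1) alt1[where p=p and q=q and r=r] alt(1)[of q p r] by (simp del: list.set)
    show "z' [p,r,q] = - z' [p,q,r]"
      unfolding z'_def perm(2) alt2[where p=p and q=q and r=r] alt(2)[of p r q] by (simp del: list.set)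
  qed
  have third: "(\<Sum>p\<in>vertices K. z' [p,u,v]) = \<beta> u v + m * c [a,u,v]"
    if "\<sigma> = {a,u,v}" "distinct [a,u,v]" for a u v
  proof -
    have "{p,u,v} = \<sigma> \<longleftrightarrow> p = a" for p
    proof
      assume "{p,u,v} = \<sigma>"
      moreover have "a \<in> \<sigma>" "a \<noteq> u" "a \<noteq> v" using that by simp_all
      ultimately show "p = a" by blast
    qed (simp add: that(1))
    then have "(\<Sum>p\<in>vertices K. z' [p,u,v])
        = \<beta> u v + (\<Sum>p\<in>vertices K. if p = a then m * c [p,u,v] else 0)"
      by (simp add: z'_def \<beta>_def sum.distrib)
    moreover have "a \<in> vertices K" using \<sigma>V that(1) by auto
    ultimately show ?thesis using fin by (simp add: sum.delta)
  qed
  have bd': "(\<Sum>p\<in>vertices K. z' [p,u,v]) = 0" for u v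
  proof (cases "{u,v} \<subseteq> \<sigma> \<and> u \<noteq> v")
    case False
    have "z' [p,u,v] = z [p,u,v]" for p
    proof (cases "{u,v} \<subseteq> \<sigma>")
      case True
      then have "c [p,u,v] = 0" using False two_cycles_support(2)[OF c, of "[p,u,v]"] by auto
      then show ?thesis by (simp add: z'_def)
    qed (auto simp: z'_def)
    then have "(\<Sum>p\<in>vertices K. z' [p,u,v]) = \<beta> u v" by (simp add: \<beta>_def)
    then show ?thesis using False \<beta>_refl \<beta>_supp by metis
  next
    case True
    have anti: "(\<Sum>p\<in>vertices K. z' [p,u,v]) = - (\<Sum>p\<in>vertices K. z' [p,v,u])" for u v
      unfolding sum_negf[symmetric] by (rule sum.cong[OF refl]) (rule alt2')
    have "(\<Sum>p\<in>vertices K. z' [p,x,y]) = \<beta> x y + m * c [w,x,y]"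
      using \<sigma>(1,2) by (intro third) auto
    then have xy: "(\<Sum>p\<in>vertices K. z' [p,x,y]) = 0"
      using m\<epsilon> alt(3)[of w x y] by (simp add: t_def \<epsilon>_def)
    have "(\<Sum>p\<in>vertices K. z' [p,y,w]) = \<beta> y w + m * c [x,y,w]"
      using \<sigma>(1,2) by (intro third) auto
    then have yw: "(\<Sum>p\<in>vertices K. z' [p,y,w]) = 0"
      using m\<epsilon> \<beta>_cyc by (simp add: \<epsilon>_def)
    have "(\<Sum>p\<in>vertices K. z' [p,w,x]) = \<beta> w x + m * c [y,w,x]"
      using \<sigma>(1,2) by (intro third) auto
    then have wx: "(\<Sum>p\<in>vertices K. z' [p,w,x]) = 0"
      using m\<epsilon> \<beta>_cyc alt(4)[of y w x] by (simp add: \<epsilon>_def)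
    have "u = x \<or> u = y \<or> u = w" "v = x \<or> v = y \<or> v = w" "u \<noteq> v"
      using True \<sigma>(1) by auto
    moreover have "(\<Sum>p\<in>vertices K. z' [p,y,x]) = 0" "(\<Sum>p\<in>vertices K. z' [p,w,y]) = 0"
      "(\<Sum>p\<in>vertices K. z' [p,x,w]) = 0"
      using xy yw wx anti[of y x] anti[of w y] anti[of x w] by simp_all
    ultimately show ?thesis using xy yw wx by (elim disjE) simp_all
  qed
  have "z' \<in> two_cycles K"
  proof (rule two_cyclesI)
    show "length s = 3 \<and> distinct s \<and> set s \<in> K" if "z' s \<noteq> 0" for s
      using that supp[of s] two_cycles_support[OF c, of s]
      by (cases "z s = 0") (auto simp: z'_def split: if_splits)
    show "(\<Sum>v\<in>vertices K. z' (v # s)) = 0" for s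
    proof (cases "length s = 2")
      case True
      then obtain u v where "s = [u,v]" by (auto simp: numeral_2_eq_2 length_Suc_conv)
      then show ?thesis using bd' by simp
    next
      case False
      have "z (v # s) = 0" "c (v # s) = 0" for v
        using False supp[of "v # s"] two_cycles_support(1)[OF c, of "v # s"] by force+
      then have "z' (v # s) = 0" for v by (simp add: z'_def)
      then show ?thesis by simp
    qed
  qed (rule alt1' alt2')+
  then obtain m' :: int where m': "z' = (\<lambda>s. m' * c s)"
    using fc unfolding fundamental_cycle_def by blast
  have "z [x,y,w] = 0" using supp[of "[x,y,w]"] \<sigma>(1) by auto
  then have "m * \<epsilon> = m' * \<epsilon>"
    using fun_cong[OF m', of "[x,y,w]"] \<sigma>(1) by (simp add: z'_def \<epsilon>_def)
  then have "m = m'" using \<epsilon>2 by auto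
  show ?thesis
  proof
    show "z s = m * c s" if "set s \<noteq> \<sigma>" for s
      using fun_cong[OF m', of s] that \<open>m = m'\<close> by (simp add: z'_def)
    show "(\<Sum>p\<in>vertices K. z [p,x,y]) = - m * c [x,y,w]"
      using m\<epsilon> by (simp add: t_def \<beta>_def \<epsilon>_def)
  qed
qed

text \<open>
  The homological half of being a closed oriented surface; the homeomorphism type of the carrier is
  tracked separately.
\<close>

definition surface_complex :: "'v set set \<Rightarrow> ('v list \<Rightarrow> int) \<Rightarrow> bool" where
  "surface_complex K c \<longleftrightarrow>
    finite_simplicial_complex K \<and> (\<forall>\<sigma>\<in>K. card \<sigma> \<le> 3) \<and> fundamental_cycle K c"

lemma finite_vertices: "finite_simplicial_complex K \<Longrightarrow> finite (vertices K)"
  by (auto simp: finite_simplicial_complex_def)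

lemma face_in_complex:
  "finite_simplicial_complex K \<Longrightarrow> \<sigma> \<in> K \<Longrightarrow> \<tau> \<subseteq> \<sigma> \<Longrightarrow> \<tau> \<noteq> {} \<Longrightarrow> \<tau> \<in> K"
  unfolding finite_simplicial_complex_def by blast

text \<open>
  The two complexes overlap in the full triangle \<open>\<sigma>\<close>, which is removed after gluing; the orientations are
  chosen such that the two cycles cancel there.
\<close>

locale triangle_gluing =
  fixes K L :: "'v set set" and c e :: "'v list \<Rightarrow> int" and x y w :: 'v and \<sigma> :: "'v set"
  assumes K: "surface_complex K c" and L: "surface_complex L e"
    and \<sigma>: "\<sigma> = {x,y,w}" and distinct: "distinct [x,y,w]"
    and \<sigma>K: "\<sigma> \<in> K" and \<sigma>L: "\<sigma> \<in> L" and inter: "vertices K \<inter> vertices L = \<sigma>"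
    and opposite: "e [x,y,w] = - c [x,y,w]"
begin

definition glued :: "'v set set" where "glued = K \<union> L - {\<sigma>}"

lemma complexes: "finite_simplicial_complex K" "finite_simplicial_complex L"
  and dims: "\<forall>\<sigma>\<in>K. card \<sigma> \<le> 3" "\<forall>\<sigma>\<in>L. card \<sigma> \<le> 3"
  and fcs: "fundamental_cycle K c" "fundamental_cycle L e"
  and cycles: "c \<in> two_cycles K" "e \<in> two_cycles L"
  using K L by (auto simp: surface_complex_def fundamental_cycle_def)

lemma finV: "finite (vertices K)" "finite (vertices L)"
  using complexes finite_vertices by blast+

lemma card_\<sigma>: "card \<sigma> = 3" using \<sigma> distinct by simp

lemma common_face: "\<tau> \<in> K \<Longrightarrow> \<tau> \<in> L \<Longrightarrow> \<tau> \<subseteq> \<sigma>" using inter by blast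

lemma common_triangle:
  assumes "\<tau> \<in> K" "\<tau> \<in> L" "card \<tau> = 3" shows "\<tau> = \<sigma>"
proof -
  have "finite \<sigma>" using \<sigma> by simp
  then show ?thesis using common_face[OF assms(1,2)] assms(3) card_\<sigma> by (simp add: card_subset_eq)
qed

lemma vertices_glued: "vertices glued = vertices K \<union> vertices L"
proof
  show "vertices K \<union> vertices L \<subseteq> vertices glued"
  proof
    fix v assume "v \<in> vertices K \<union> vertices L"
    then have "{v} \<in> K \<union> L" using complexes by (auto intro: face_in_complex)
    moreover have "{v} \<noteq> \<sigma>" using card_\<sigma> by auto
    ultimately show "v \<in> vertices glued" unfolding glued_def by blast
  qed
qed (auto simp: glued_def)

lemma card_vertices_glued: "card (vertices glued) + 3 = card (vertices K) + card (vertices L)"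
  using card_Un_Int[OF finV] by (simp add: vertices_glued inter card_\<sigma>)

lemma dim_glued: "\<forall>\<sigma>\<in>glued. card \<sigma> \<le> 3"
  using dims by (auto simp: glued_def)

text \<open>
  As \<open>\<sigma>\<close> is not a proper face, removing it leaves a complex.
\<close>

lemma maximal_triangle:
  assumes "\<tau> \<in> K \<union> L" shows "\<not> \<sigma> \<subset> \<tau>"
proof
  assume "\<sigma> \<subset> \<tau>"
  moreover have "finite \<tau>" using assms complexes unfolding finite_simplicial_complex_def by blast
  ultimately have "card \<sigma> < card \<tau>" by (simp add: psubset_card_mono)
  then show False using assms dims card_\<sigma> by force
qed

lemma complex_minus: "finite_simplicial_complex (K - {\<sigma>})" "finite_simplicial_complex (L - {\<sigma>})"
  using complexes maximal_triangle unfolding finite_simplicial_complex_def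
  by (auto simp: psubset_eq)

lemma complex_glued: "finite_simplicial_complex glued"
proof -
  have "glued = (K - {\<sigma>}) \<union> (L - {\<sigma>})" by (auto simp: glued_def)
  then show ?thesis
    using complex_minus unfolding finite_simplicial_complex_def
    by (simp only: finite_Un ball_Un Un_iff) blast
qed

lemma opposite_on_\<sigma>:
  assumes "set s = \<sigma>" shows "e s = - c s"
proof (cases "length s = 3")
  case True
  then have "distinct s" using assms card_\<sigma> by (simp add: card_distinct)
  moreover have "set s = set [x,y,w]" using assms \<sigma> by simp
  ultimately have "mset s = mset [x,y,w]"
    using distinct set_eq_iff_mset_eq_distinct by blast
  then obtain \<pi> where \<pi>: "\<pi> permutes {..<length [x,y,w]}" "permute_list \<pi> [x,y,w] = s"
    using mset_eq_permutation by metis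
  have "d s = sign \<pi> * d [x,y,w]" if "d \<in> two_cycles M" for d M
    using that \<pi> unfolding two_cycles_def chains_def by blast
  from this[OF cycles(1)] this[OF cycles(2)] show ?thesis using opposite by simp
next
  case False
  then have "c s = 0" "e s = 0" using two_cycles_support(1) cycles by blast+
  then show ?thesis by simp
qed

lemma glued_in_two_cycles: "(\<lambda>s. c s + e s) \<in> two_cycles glued"
proof (rule two_cyclesI)
  show "length s = 3 \<and> distinct s \<and> set s \<in> glued" if "c s + e s \<noteq> 0" for s
  proof -
    have "set s \<noteq> \<sigma>" using that opposite_on_\<sigma>[of s] by auto
    then show ?thesis
      using that two_cycles_support[OF cycles(1), of s] two_cycles_support[OF cycles(2), of s]
      by (cases "c s = 0") (simp_all add: glued_def)
  qed
  show "(\<Sum>v\<in>vertices glued. c (v # s) + e (v # s)) = 0" for s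
    using two_cycles_boundary[OF cycles(1), of "vertices glued" s]
      two_cycles_boundary[OF cycles(2), of "vertices glued" s] finV
    by (simp add: vertices_glued sum.distrib)
next
  fix p q r
  show "c [q,p,r] + e [q,p,r] = - (c [p,q,r] + e [p,q,r])"
    using two_cycles_alternating(1)[OF cycles(1), of q p r] two_cycles_alternating(1)[OF cycles(2), of q p r]
    by linarith
  show "c [p,r,q] + e [p,r,q] = - (c [p,q,r] + e [p,q,r])"
    using two_cycles_alternating(2)[OF cycles(1), of p r q] two_cycles_alternating(2)[OF cycles(2), of p r q]
    by linarith
qed

text \<open>
  A cycle of the glued complex splits into its parts on the two sides. Their boundaries cancel, so
  both are supported in common edges, that is, on the rim of \<open>\<sigma>\<close>. By \<open>relative_cycle_multiple\<close> each part is
  a multiple of the fundamental cycle of its side, and equality of the two boundaries on one edge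
  forces equal factors.
\<close>

lemma glued_cycle_multiple:
  assumes z: "z \<in> two_cycles glued"
  shows "\<exists>m::int. z = (\<lambda>s. m * (c s + e s))"
proof -
  define zK where "zK s = (if set s \<in> K then z s else 0)" for s
  define zL where "zL s = (if set s \<in> L then z s else 0)" for s
  have z\<sigma>: "z s = 0" if "set s = \<sigma>" for s
    using two_cycles_support(3)[OF z, of s] that by (auto simp: glued_def)
  have split: "z s = zK s + zL s" for s
  proof (cases "z s = 0")
    case False
    then have "length s = 3" "distinct s" "set s \<in> glued" using two_cycles_support[OF z] by blast+
    moreover from this have "card (set s) = 3" by (simp add: distinct_card)
    ultimately show ?thesis
      using common_triangle[of "set s"] by (auto simp: zK_def zL_def glued_def)
  qed (simp add: zK_def zL_def)
  have suppK: "length s = 3 \<and> distinct s \<and> set s \<in> K \<and> set s \<noteq> \<sigma>" if "zK s \<noteq> 0" for s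
    using that two_cycles_support[OF z, of s] by (auto simp: zK_def glued_def split: if_splits)
  have suppL: "length s = 3 \<and> distinct s \<and> set s \<in> L \<and> set s \<noteq> \<sigma>" if "zL s \<noteq> 0" for s
    using that two_cycles_support[OF z, of s] by (auto simp: zL_def glued_def split: if_splits)
  have alt: "zK [q,p,r] = - zK [p,q,r]" "zK [p,r,q] = - zK [p,q,r]"
    "zL [q,p,r] = - zL [p,q,r]" "zL [p,r,q] = - zL [p,q,r]" for p q r
  proof -
    have perm: "set [q,p,r] = set [p,q,r]" "set [p,r,q] = set [p,q,r]" by auto
    show "zK [q,p,r] = - zK [p,q,r]" "zL [q,p,r] = - zL [p,q,r]"
      unfolding zK_def zL_def perm(1) two_cycles_alternating(1)[OF z, of q p r] by (simp_all del: list.set)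
    show "zK [p,r,q] = - zK [p,q,r]" "zL [p,r,q] = - zL [p,q,r]"
      unfolding zK_def zL_def perm(2) two_cycles_alternating(2)[OF z, of p r q] by (simp_all del: list.set)
  qed
  have bd: "(\<Sum>p\<in>vertices K. zK [p,u,v]) + (\<Sum>p\<in>vertices L. zL [p,u,v]) = 0" for u v
  proof -
    have "(\<Sum>p\<in>vertices K. zK [p,u,v]) = (\<Sum>p\<in>vertices glued. zK [p,u,v])"
      using finV suppK by (intro sum.mono_neutral_left) (fastforce simp: vertices_glued)+
    moreover have "(\<Sum>p\<in>vertices L. zL [p,u,v]) = (\<Sum>p\<in>vertices glued. zL [p,u,v])"
      using finV suppL by (intro sum.mono_neutral_left) (fastforce simp: vertices_glued)+
    moreover have "(\<Sum>p\<in>vertices glued. z [p,u,v]) = 0"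
      using z by (simp add: two_cycles_def)
    ultimately show ?thesis by (simp add: split sum.distrib)
  qed
  have edgeK: "{u,v} \<subseteq> vertices K" if nz: "(\<Sum>p\<in>vertices K. zK [p,u,v]) \<noteq> 0" for u v
  proof -
    obtain p where "zK [p,u,v] \<noteq> 0" using nz by (meson sum.neutral)
    then have "{p,u,v} \<in> K" using suppK[of "[p,u,v]"] by simp
    then show ?thesis by blast
  qed
  have edgeL: "{u,v} \<subseteq> vertices L" if nz: "(\<Sum>p\<in>vertices L. zL [p,u,v]) \<noteq> 0" for u v
  proof -
    obtain p where "zL [p,u,v] \<noteq> 0" using nz by (meson sum.neutral)
    then have "{p,u,v} \<in> L" using suppL[of "[p,u,v]"] by simp
    then show ?thesis by blast
  qed
  have bdK: "{u,v} \<subseteq> \<sigma>" if "(\<Sum>p\<in>vertices K. zK [p,u,v]) \<noteq> 0" for u v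
    using edgeK[OF that] edgeL[of u v] bd[of u v] that inter by auto
  have bdL: "{u,v} \<subseteq> \<sigma>" if "(\<Sum>p\<in>vertices L. zL [p,u,v]) \<noteq> 0" for u v
    using edgeL[OF that] edgeK[of u v] bd[of u v] that inter by auto
  obtain m where m: "\<And>s. set s \<noteq> \<sigma> \<Longrightarrow> zK s = m * c s"
      "(\<Sum>p\<in>vertices K. zK [p,x,y]) = - m * c [x,y,w]"
    using relative_cycle_multiple[where z = zK and K = K and c = c and \<sigma> = \<sigma> and x = x and y = y and w = w,
        OF finV(1) fcs(1) \<sigma> distinct \<sigma>K suppK alt(1,2) bdK] by blast
  obtain n where n: "\<And>s. set s \<noteq> \<sigma> \<Longrightarrow> zL s = n * e s"
      "(\<Sum>p\<in>vertices L. zL [p,x,y]) = - n * e [x,y,w]"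
    using relative_cycle_multiple[where z = zL and K = L and c = e and \<sigma> = \<sigma> and x = x and y = y and w = w,
        OF finV(2) fcs(2) \<sigma> distinct \<sigma>L suppL alt(3,4) bdL] by blast
  have "[x,y,w] \<in> ordered_simplices 2 K"
    using \<sigma> distinct \<sigma>K by (simp add: ordered_simplices_def)
  then have "c [x,y,w] \<noteq> 0" using fcs(1) unfolding fundamental_cycle_def by force
  then have "m = n" using m(2) n(2) bd[of x y] opposite by simp
  have "z s = m * (c s + e s)" for s
  proof (cases "set s = \<sigma>")
    case True
    then show ?thesis using z\<sigma> opposite_on_\<sigma> by simp
  next
    case False
    then show ?thesis using m(1) n(1) \<open>m = n\<close> by (simp add: split distrib_left)
  qed
  then show ?thesis by blast
qed

lemma glued_unit:
  assumes "s \<in> ordered_simplices 2 glued" shows "\<bar>c s + e s\<bar> = 1"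
proof -
  have s: "length s = 3" "distinct s" "set s \<in> K \<union> L" "set s \<noteq> \<sigma>" "card (set s) = 3"
    using assms by (auto simp: ordered_simplices_def glued_def distinct_card)
  show ?thesis
  proof (cases "set s \<in> K")
    case True
    then have "e s = 0" using common_triangle s two_cycles_support(3)[OF cycles(2), of s] by blast
    moreover have "\<bar>c s\<bar> = 1"
      using True s fcs(1) by (simp add: fundamental_cycle_def ordered_simplices_def)
    ultimately show ?thesis by simp
  next
    case False
    then have "c s = 0" using two_cycles_support(3)[OF cycles(1), of s] by blast
    moreover have "\<bar>e s\<bar> = 1"
      using False s fcs(2) by (simp add: fundamental_cycle_def ordered_simplices_def)
    ultimately show ?thesis by simp
  qed
qed

lemma surface_complex_glued:
  assumes "\<exists>s. c s + e s \<noteq> 0"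
  shows "surface_complex glued (\<lambda>s. c s + e s)"
  unfolding surface_complex_def fundamental_cycle_def
  using complex_glued dim_glued glued_in_two_cycles glued_cycle_multiple glued_unit assms by blast

end

section \<open>Push-forward of cycles\<close>

lemma finite_ordered_simplices:
  assumes "finite (vertices K)" shows "finite (ordered_simplices n K)"
proof (rule finite_subset)
  show "ordered_simplices n K \<subseteq> {s. set s \<subseteq> vertices K \<and> length s = Suc n}"
    by (auto simp: ordered_simplices_def)
  show "finite {s. set s \<subseteq> vertices K \<and> length s = Suc n}"
    using assms by (rule finite_lists_length_eq)
qed

text \<open>
  Any finite set that supports \<open>c\<close> may be used to compute the push-forward, which allows chains on
  different complexes to be pushed forward by one common sum.
\<close>

lemma chain_map_sum:
  assumes "finite A" and "finite (vertices K)" and "\<And>t. c t \<noteq> 0 \<Longrightarrow> t \<in> A"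
    and "c \<in> chains n K"
  shows "chain_map n K f c s = (if distinct s then \<Sum>t\<in>A. if map f t = s then c t else 0 else 0)"
proof -
  have fin: "finite (ordered_simplices n K)" using finite_ordered_simplices[OF assms(2)] .
  have 0: "c t = 0" if "t \<notin> ordered_simplices n K" for t
    using assms(4) that unfolding chains_def by blast
  have "(\<Sum>t | t \<in> ordered_simplices n K \<and> map f t = s. c t)
      = (\<Sum>t\<in>ordered_simplices n K. if map f t = s then c t else 0)"
    using fin by (simp add: sum.inter_filter)
  also have "\<dots> = (\<Sum>t\<in>ordered_simplices n K \<union> A. if map f t = s then c t else 0)"
    using fin assms(1) 0 by (intro sum.mono_neutral_left) auto
  also have "\<dots> = (\<Sum>t\<in>A. if map f t = s then c t else 0)"
  proof (rule sum.mono_neutral_right)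
    show "\<forall>t\<in>ordered_simplices n K \<union> A - A. (if map f t = s then c t else 0) = 0"
      using assms(3) by fastforce
  qed (use fin assms(1) in auto)
  finally show ?thesis by (simp add: chain_map_def)
qed

lemma two_cycles_chains: "c \<in> two_cycles K \<Longrightarrow> c \<in> chains 2 K"
  by (simp add: two_cycles_def)

lemma chain_map_inj:
  assumes c: "c \<in> two_cycles K" and fin: "finite (vertices K)" and inj: "inj_on f (vertices K)"
    and same: "\<And>t. set t \<subseteq> vertices K \<Longrightarrow> c' (map f t) = c t"
    and supp: "\<And>s. c' s \<noteq> 0 \<Longrightarrow> distinct s \<and> set s \<subseteq> f ` vertices K"
  shows "chain_map 2 K f c = c'"
proof
  fix s
  let ?A = "ordered_simplices 2 K"
  have c0: "c t \<noteq> 0 \<Longrightarrow> t \<in> ?A" for t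
    using two_cycles_chains[OF c] unfolding chains_def by blast
  note sum = chain_map_sum[OF finite_ordered_simplices[OF fin] fin c0 two_cycles_chains[OF c]]
  have AV: "t \<in> ?A \<Longrightarrow> set t \<subseteq> vertices K" for t by (auto simp: ordered_simplices_def)
  show "chain_map 2 K f c s = c' s"
  proof (cases "\<exists>t\<in>?A. map f t = s")
    case True
    then obtain t where t: "t \<in> ?A" "map f t = s" by blast
    have "map f u = s \<longleftrightarrow> u = t" if "u \<in> ?A" for u
      using t AV[OF that] AV[OF t(1)] inj inj_on_map_eq_map[of f u t]
      by (metis inj_on_subset sup.bounded_iff)
    then have "(\<Sum>u\<in>?A. if map f u = s then c u else 0) = (\<Sum>u\<in>?A. if u = t then c u else 0)"
      by (intro sum.cong) auto
    also have "\<dots> = c t" using t finite_ordered_simplices[OF fin] by (simp add: sum.delta)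
    also have "\<dots> = c' s" using same[OF AV[OF t(1)]] t by simp
    finally show ?thesis using sum[of f s] supp[of s] by (cases "distinct s") auto
  next
    case False
    have "c' s = 0"
    proof (rule ccontr)
      assume nz: "c' s \<noteq> 0"
      then have "set s \<subseteq> f ` vertices K" using supp[of s] by simp
      let ?t = "map (inv_into (vertices K) f) s"
      have inv: "inv_into (vertices K) f v \<in> vertices K \<and> f (inv_into (vertices K) f v) = v"
        if "v \<in> set s" for v
      proof -
        have "v \<in> f ` vertices K" using \<open>set s \<subseteq> f ` vertices K\<close> that by blast
        from inv_into_into[OF this] f_inv_into_f[OF this] show ?thesis ..
      qed
      have t: "set ?t \<subseteq> vertices K" unfolding set_map using inv by blast
      have t': "map f ?t = s" unfolding map_map using inv by (intro map_idI) simp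
      have "c ?t \<noteq> 0" using nz same[OF t] t' by simp
      then show False using False c0[of ?t] t' by blast
    qed
    moreover have "(\<Sum>u\<in>?A. if map f u = s then c u else 0) = 0"
      using False by (intro sum.neutral) auto
    ultimately show ?thesis using sum[of f s] by simp
  qed
qed

text \<open>
  The push-forward is a 2-cycle in a complex with at most one triangle, so it vanishes. Concretely:
  for fixed \<open>y\<close> and \<open>w\<close> over \<open>q\<close> and \<open>r\<close>, the boundary relation sums \<open>c [x, y, w]\<close> over all \<open>x\<close>, and the
  terms with \<open>x\<close> over \<open>q\<close> or over \<open>r\<close> cancel in pairs because \<open>c\<close> is alternating.
\<close>

lemma chain_map_degenerate:
  assumes c: "c \<in> two_cycles K" and fin: "finite (vertices K)"
    and S: "finite S" "card S \<le> 3" "f ` vertices K \<subseteq> S"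
  shows "chain_map 2 K f c = (\<lambda>s. 0)"
proof
  fix s
  define V where "V = vertices K"
  have finV: "finite V" and SV: "f ` V \<subseteq> S" using fin S(3) by (simp_all only: V_def)
  have bd: "(\<Sum>v\<in>V. c (v # s)) = 0" for s using c unfolding V_def two_cycles_def by blast
  have supp: "set t \<subseteq> V" if "c t \<noteq> 0" for t
    using two_cycles_support(3)[OF c that] unfolding V_def by blast
  let ?A = "(\<lambda>(x,y,w). [x,y,w]) ` (V \<times> V \<times> V)"
  have c0: "t \<in> ?A" if nz: "c t \<noteq> 0" for t
  proof -
    obtain x y w where "t = [x,y,w]"
      using two_cycles_support(1)[OF c nz] by (auto simp: numeral_3_eq_3 length_Suc_conv)
    then show ?thesis using supp[OF nz] by (auto intro!: image_eqI[of _ _ "(x,y,w)"])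
  qed
  have sum: "chain_map 2 K f c s
      = (if distinct s then \<Sum>t\<in>?A. if map f t = s then c t else 0 else 0)"
    using finV by (intro chain_map_sum c0 fin two_cycles_chains[OF c]) simp_all
  show "chain_map 2 K f c s = 0"
  proof (cases "distinct s \<and> length s = 3 \<and> set s \<subseteq> S")
    case False
    have "map f t \<noteq> s" if "distinct s" "t \<in> ?A" for t
    proof
      assume "map f t = s"
      moreover have t: "length t = 3" "set t \<subseteq> V" using that(2) by auto
      ultimately have "length s = 3" "set s = f ` set t" by (simp_all flip: set_map length_map[of f t])
      moreover from this t have "set s \<subseteq> S" using SV by blast
      ultimately have "length s = 3" "set s \<subseteq> S" by simp_all
      then show False using False that(1) by simp
    qed
    then show ?thesis using sum by (simp add: sum.neutral)
  next
    case True
    then obtain p q r where s: "s = [p,q,r]" by (auto simp: numeral_3_eq_3 length_Suc_conv)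
    have "card (set s) = 3" using True distinct_card by force
    then have Spqr: "S = {p,q,r}"
      using S True card_subset_eq[of S "set s"] card_mono[of S "set s"] by (simp add: s)
    define G where "G p = (\<Sum>x\<in>V. \<Sum>y\<in>V. \<Sum>w\<in>V. if f x = p \<and> f y = q \<and> f w = r then c [x,y,w] else 0)" for p
    have "chain_map 2 K f c s = (\<Sum>t\<in>?A. if map f t = s then c t else 0)"
      using sum True by simp
    also have "\<dots> = G p"
      unfolding G_def
      by (subst sum.reindex) (auto simp: inj_on_def sum.cartesian_product s split_def)
    finally have push: "chain_map 2 K f c s = G p" .
    \<comment> \<open>Summing over all vertices in the first place gives the boundary.\<close>
    have "G p + G q + G r = (\<Sum>x\<in>V. \<Sum>y\<in>V. \<Sum>w\<in>V. if f y = q \<and> f w = r then c [x,y,w] else 0)"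
      unfolding G_def sum.distrib[symmetric]
    proof (intro sum.cong refl)
      fix x y w assume "x \<in> V"
      then have "f x = p \<or> f x = q \<or> f x = r" using SV Spqr by auto
      then show "(if f x = p \<and> f y = q \<and> f w = r then c [x,y,w] else 0)
          + (if f x = q \<and> f y = q \<and> f w = r then c [x,y,w] else 0)
          + (if f x = r \<and> f y = q \<and> f w = r then c [x,y,w] else 0)
          = (if f y = q \<and> f w = r then c [x,y,w] else 0)"
        using True by (auto simp: s)
    qed
    also have "\<dots> = (\<Sum>y\<in>V. \<Sum>x\<in>V. \<Sum>w\<in>V. if f y = q \<and> f w = r then c [x,y,w] else 0)"
      by (rule sum.swap)
    also have "\<dots> = (\<Sum>y\<in>V. \<Sum>w\<in>V. \<Sum>x\<in>V. if f y = q \<and> f w = r then c [x,y,w] else 0)"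
      by (intro sum.cong refl sum.swap)
    also have "\<dots> = 0"
    proof -
      have "(\<Sum>x\<in>V. if f y = q \<and> f w = r then c [x,y,w] else 0) = 0" for y w
        using bd[of "[y,w]"] by (cases "f y = q \<and> f w = r") auto
      then show ?thesis by simp
    qed
    finally have G: "G p + G q + G r = 0" .
    have "G q = (\<Sum>y\<in>V. \<Sum>x\<in>V. \<Sum>w\<in>V. if f x = q \<and> f y = q \<and> f w = r then c [x,y,w] else 0)"
      unfolding G_def by (rule sum.swap)
    also have "\<dots> = (\<Sum>y\<in>V. \<Sum>x\<in>V. \<Sum>w\<in>V. - (if f y = q \<and> f x = q \<and> f w = r then c [y,x,w] else 0))"
    proof (intro sum.cong refl)
      fix y x w
      show "(if f x = q \<and> f y = q \<and> f w = r then c [x,y,w] else 0)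
          = - (if f y = q \<and> f x = q \<and> f w = r then c [y,x,w] else 0)"
        using two_cycles_alternating(1)[OF c, of x y w] by auto
    qed
    also have "\<dots> = - G q" by (simp add: G_def sum_negf)
    finally have Gq: "G q = 0" by simp
    have "G r = (\<Sum>w\<in>V. \<Sum>y\<in>V. \<Sum>x\<in>V. if f x = r \<and> f y = q \<and> f w = r then c [x,y,w] else 0)"
    proof -
      have "G r = (\<Sum>x\<in>V. \<Sum>w\<in>V. \<Sum>y\<in>V. if f x = r \<and> f y = q \<and> f w = r then c [x,y,w] else 0)"
        unfolding G_def by (intro sum.cong refl sum.swap)
      also have "\<dots> = (\<Sum>w\<in>V. \<Sum>x\<in>V. \<Sum>y\<in>V. if f x = r \<and> f y = q \<and> f w = r then c [x,y,w] else 0)"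
        by (rule sum.swap)
      also have "\<dots> = (\<Sum>w\<in>V. \<Sum>y\<in>V. \<Sum>x\<in>V. if f x = r \<and> f y = q \<and> f w = r then c [x,y,w] else 0)"
        by (intro sum.cong refl sum.swap)
      finally show ?thesis .
    qed
    also have "\<dots> = (\<Sum>w\<in>V. \<Sum>y\<in>V. \<Sum>x\<in>V. - (if f w = r \<and> f y = q \<and> f x = r then c [w,y,x] else 0))"
    proof (intro sum.cong refl)
      fix w y x
      show "(if f x = r \<and> f y = q \<and> f w = r then c [x,y,w] else 0)
          = - (if f w = r \<and> f y = q \<and> f x = r then c [w,y,x] else 0)"
        using two_cycles_alternating(5)[OF c, of x y w] by auto
    qed
    also have "\<dots> = - G r" by (simp add: G_def sum_negf)
    finally have "G r = 0" by simp
    then show ?thesis using G Gq push by simp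
  qed
qed

context triangle_gluing
begin

lemma chain_map_glued:
  assumes "\<And>v. v \<in> vertices K \<Longrightarrow> h v = f v" and "\<And>v. v \<in> vertices L \<Longrightarrow> h v = f' v"
  shows "chain_map 2 glued h (\<lambda>s. c s + e s) = (\<lambda>s. chain_map 2 K f c s + chain_map 2 L f' e s)"
proof
  fix s
  let ?A = "{t. set t \<subseteq> vertices K \<union> vertices L \<and> length t = 3}"
  have finA: "finite ?A" using finV by (intro finite_lists_length_eq) simp
  have cA: "t \<in> ?A" if "c t \<noteq> 0" for t using two_cycles_support[OF cycles(1) that] by auto
  have eA: "t \<in> ?A" if "e t \<noteq> 0" for t using two_cycles_support[OF cycles(2) that] by auto
  have ceA: "t \<in> ?A" if "c t + e t \<noteq> 0" for t
    using cA[of t] eA[of t] that by (cases "c t = 0") auto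
  have hc: "(if map h t = s then c t else 0) = (if map f t = s then c t else 0)" for t
  proof (cases "c t = 0")
    case False
    then have "set t \<subseteq> vertices K" using two_cycles_support(3)[OF cycles(1)] by blast
    then have "map h t = map f t" using assms(1) by (auto intro: map_cong)
    then show ?thesis by (simp only:)
  qed simp
  have he: "(if map h t = s then e t else 0) = (if map f' t = s then e t else 0)" for t
  proof (cases "e t = 0")
    case False
    then have "set t \<subseteq> vertices L" using two_cycles_support(3)[OF cycles(2)] by blast
    then have "map h t = map f' t" using assms(2) by (auto intro: map_cong)
    then show ?thesis by (simp only:)
  qed simp
  have "(\<Sum>t\<in>?A. if map h t = s then c t + e t else 0)
      = (\<Sum>t\<in>?A. if map h t = s then c t else 0) + (\<Sum>t\<in>?A. if map h t = s then e t else 0)"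
    unfolding sum.distrib[symmetric] by (intro sum.cong refl) simp
  then show "chain_map 2 glued h (\<lambda>s. c s + e s) s = chain_map 2 K f c s + chain_map 2 L f' e s"
    using chain_map_sum[OF finA finV(1) cA two_cycles_chains[OF cycles(1)], of f s]
      chain_map_sum[OF finA finV(2) eA two_cycles_chains[OF cycles(2)], of f' s]
      chain_map_sum[OF finA _ ceA two_cycles_chains[OF glued_in_two_cycles], of h s] finV
    by (simp add: vertices_glued hc he)
qed

lemma simplicial_map_glued:
  assumes "simplicial_map K T f" and "simplicial_map L T f'"
    and "\<And>v. v \<in> vertices K \<Longrightarrow> h v = f v" and "\<And>v. v \<in> vertices L \<Longrightarrow> h v = f' v"
  shows "simplicial_map glued T h"
  unfolding simplicial_map_def
proof
  fix \<tau> assume "\<tau> \<in> glued"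
  then consider "\<tau> \<in> K" | "\<tau> \<in> L" by (auto simp: glued_def)
  then show "h ` \<tau> \<in> T"
  proof cases
    case 1
    then have "h ` \<tau> = f ` \<tau>" using assms(3) by (intro image_cong) auto
    then show ?thesis using 1 assms(1) by (simp add: simplicial_map_def)
  next
    case 2
    then have "h ` \<tau> = f' ` \<tau>" using assms(4) by (intro image_cong) auto
    then show ?thesis using 2 assms(2) by (simp add: simplicial_map_def)
  qed
qed

end

section \<open>Cyclic tori\<close>

text \<open>
  The triangular grid in the plane has the lattice points \<open>(p, q)\<close> as vertices and is cut into the
  triangles \<open>(p, q), (p + 1, q), (p, q + 1)\<close> and \<open>(p + 1, q), (p, q + 1), (p + 1, q + 1)\<close>. Giving \<open>(p, q)\<close> the
  index \<open>p + 3 q\<close> and reading indices modulo \<open>n\<close> yields this complex. An arbitrary labelling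
  \<open>\<rho>\<close> of the indices is allowed, so that copies with prescribed vertices are available.
\<close>

definition cyclic_torus :: "(int \<Rightarrow> 'v) \<Rightarrow> 'v set set" where
  "cyclic_torus \<rho> =
    {\<tau>. \<tau> \<noteq> {} \<and> (\<exists>x. \<tau> \<subseteq> {\<rho> x, \<rho> (x + 1), \<rho> (x + 3)} \<or> \<tau> \<subseteq> {\<rho> x, \<rho> (x + 2), \<rho> (x + 3)})}"

text \<open>
  The neighbours of the vertex \<open>x\<close> of the grid are the \<open>x + i\<close> with \<open>i\<close> in \<open>link\<close>. They form a hexagon, and \<open>turn\<close> goes
  around it counterclockwise.
\<close>

definition link :: "int set" where "link = {1, 3, 2, -1, -3, -2}"

definition turn :: "int \<Rightarrow> int" where
  "turn i = (if i = 1 then 3 else if i = 3 then 2 else if i = 2 then -1 else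
    if i = -1 then -3 else if i = -3 then -2 else 1)"

definition positive :: "(int \<Rightarrow> 'v) \<Rightarrow> 'v \<Rightarrow> 'v \<Rightarrow> 'v \<Rightarrow> bool" where
  "positive \<rho> a b c \<longleftrightarrow> (\<exists>x. \<exists>i\<in>link. a = \<rho> x \<and> b = \<rho> (x + i) \<and> c = \<rho> (x + turn i))"

definition torus_cycle :: "(int \<Rightarrow> 'v) \<Rightarrow> 'v list \<Rightarrow> int" where
  "torus_cycle \<rho> s =
    (case s of [a, b, c] \<Rightarrow> of_bool (positive \<rho> a b c) - of_bool (positive \<rho> a c b) | _ \<Rightarrow> 0)"

lemma torus_cycle_triple:
  "torus_cycle \<rho> [a, b, c] = of_bool (positive \<rho> a b c) - of_bool (positive \<rho> a c b)"
  by (simp add: torus_cycle_def)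

lemma link_cases:
  assumes "i \<in> link"
  obtains "i = 1" | "i = 3" | "i = 2" | "i = -1" | "i = -3" | "i = -2"
  using assms by (auto simp: link_def)

lemma turn_simps [simp]:
  "turn 1 = 3" "turn 3 = 2" "turn 2 = -1" "turn (-1) = -3" "turn (-3) = -2" "turn (-2) = 1"
  by (simp_all add: turn_def)

lemma link_simps [simp]:
  "1 \<in> link" "3 \<in> link" "2 \<in> link" "-1 \<in> link" "-3 \<in> link" "-2 \<in> link"
  by (simp_all add: link_def)

text \<open>
  The expression \<open>turn i - i\<close> is the direction of the third vertex of a triangle as seen from its second
  one, and \<open>- i\<close> that of the first; the fourth and the last equation say that rotating a triangle
  keeps it positive.
\<close>

lemma link_turn:
  assumes "i \<in> link"
  shows "turn i \<in> link" "turn i - i \<in> link" "- i \<in> link" "turn (turn i - i) = - i"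
    "turn (turn i) \<noteq> i" "\<bar>i\<bar> \<le> 3" "i \<noteq> 0" "turn i \<noteq> i"
    "turn (- turn i) + turn i = i"
  using assms by (cases rule: link_cases; simp)+

lemma positive_rotate: "positive \<rho> a b c \<Longrightarrow> positive \<rho> b c a"
proof -
  assume "positive \<rho> a b c"
  then obtain x i where i: "i \<in> link" and abc: "a = \<rho> x" "b = \<rho> (x + i)" "c = \<rho> (x + turn i)"
    by (auto simp: positive_def)
  have "b = \<rho> (x + i) \<and> c = \<rho> (x + i + (turn i - i)) \<and> a = \<rho> (x + i + turn (turn i - i))"
    using abc link_turn(4)[OF i] by simp
  then show ?thesis unfolding positive_def using link_turn(2)[OF i] by blast
qed

lemma positive_rotate_iff: "positive \<rho> b c a \<longleftrightarrow> positive \<rho> a b c"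
  using positive_rotate[of \<rho> a b c] positive_rotate[of \<rho> b c a] positive_rotate[of \<rho> c a b] by argo

lemma torus_cycle_alternating:
  "torus_cycle \<rho> [b, a, c] = - torus_cycle \<rho> [a, b, c]"
  "torus_cycle \<rho> [a, c, b] = - torus_cycle \<rho> [a, b, c]"
  using positive_rotate_iff[of \<rho> b c a] positive_rotate_iff[of \<rho> b a c] positive_rotate_iff[of \<rho> c b a]
    positive_rotate_iff[of \<rho> a c b]
  by (simp_all add: torus_cycle_triple)

text \<open>
  Two indices at which neighbours of a vertex are compared differ by at most 6, so from \<open>n = 7\<close> on a closed
  star of the grid is embedded in the quotient.
\<close>

locale cyclic_labelling =
  fixes n :: int and \<rho> :: "int \<Rightarrow> 'v"
  assumes n7: "n \<ge> 7" and label_eq: "\<rho> x = \<rho> y \<longleftrightarrow> n dvd x - y"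
begin

lemma label_near:
  assumes "\<rho> (x + i) = \<rho> (x + j)" "\<bar>i - j\<bar> \<le> 6" shows "i = j"
  using assms n7 dvd_imp_le_int[of "i - j" n] by (auto simp: label_eq)

lemma label_mod: "\<rho> (x mod n) = \<rho> x"
  by (simp add: label_eq mod_eq_dvd_iff[symmetric])

lemma range_label: "range \<rho> = \<rho> ` {0..<n}"
proof
  show "range \<rho> \<subseteq> \<rho> ` {0..<n}"
  proof
    fix v assume "v \<in> range \<rho>"
    then obtain x where "v = \<rho> x" by blast
    moreover have "x mod n \<in> {0..<n}" using n7 by simp
    ultimately show "v \<in> \<rho> ` {0..<n}" using label_mod[of x] by (metis image_eqI)
  qed
qed blast

lemma finite_range_label: "finite (range \<rho>)" by (simp add: range_label)

lemma card_range_label: "card (range \<rho>) = nat n"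
proof -
  have "inj_on \<rho> {0..<n}"
  proof (rule inj_onI)
    fix x y assume "x \<in> {0..<n}" "y \<in> {0..<n}" "\<rho> x = \<rho> y"
    then show "x = y" using dvd_imp_le_int[of "x - y" n] by (cases "x = y") (auto simp: label_eq)
  qed
  then show ?thesis by (simp add: range_label card_image)
qed

lemma triangles_in_torus:
  "{\<rho> x, \<rho> (x + 1), \<rho> (x + 3)} \<in> cyclic_torus \<rho>" "{\<rho> x, \<rho> (x + 2), \<rho> (x + 3)} \<in> cyclic_torus \<rho>"
  unfolding cyclic_torus_def by blast+

lemma vertices_torus: "vertices (cyclic_torus \<rho>) = range \<rho>"
  using triangles_in_torus(1) by (auto simp: cyclic_torus_def)

lemma finite_simplicial_complex_torus: "finite_simplicial_complex (cyclic_torus \<rho>)"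
  unfolding finite_simplicial_complex_def
proof (intro conjI ballI allI impI)
  have "cyclic_torus \<rho> \<subseteq> Pow (range \<rho>)" by (auto simp: cyclic_torus_def)
  then show "finite (cyclic_torus \<rho>)" using finite_range_label finite_subset by blast
next
  fix \<sigma> assume "\<sigma> \<in> cyclic_torus \<rho>"
  then show "finite \<sigma>" using finite_subset[of \<sigma>] by (auto simp: cyclic_torus_def)
  show "\<sigma> \<noteq> {}" using \<open>\<sigma> \<in> cyclic_torus \<rho>\<close> by (simp add: cyclic_torus_def)
next
  fix \<sigma> \<tau> assume "\<sigma> \<in> cyclic_torus \<rho>" "\<tau> \<subseteq> \<sigma> \<and> \<tau> \<noteq> {}"
  then show "\<tau> \<in> cyclic_torus \<rho>" unfolding cyclic_torus_def by blast
qed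

lemma dim_torus: "\<forall>\<sigma>\<in>cyclic_torus \<rho>. card \<sigma> \<le> 3"
proof
  fix \<sigma> assume "\<sigma> \<in> cyclic_torus \<rho>"
  then obtain a b c where "\<sigma> \<subseteq> {a, b, c}" unfolding cyclic_torus_def by blast
  then have "card \<sigma> \<le> card {a, b, c}" by (simp add: card_mono)
  also have "\<dots> \<le> 3" by (simp add: card_insert_if)
  finally show "card \<sigma> \<le> 3" .
qed

lemma positive_link: "i \<in> link \<Longrightarrow> positive \<rho> (\<rho> x) (\<rho> (x + i)) (\<rho> (x + turn i))"
  unfolding positive_def by blast

lemma positive_distinct:
  assumes "positive \<rho> a b c" shows "distinct [a, b, c]"
proof -
  obtain x i where i: "i \<in> link" and abc: "a = \<rho> x" "b = \<rho> (x + i)" "c = \<rho> (x + turn i)"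
    using assms by (auto simp: positive_def)
  note b = link_turn(6,7,8)[OF i] link_turn(6,7)[OF link_turn(1)[OF i]]
  have near: "\<bar>0 - i\<bar> \<le> 6" "\<bar>0 - turn i\<bar> \<le> 6" "\<bar>i - turn i\<bar> \<le> 6"
    using b(1,4) by linarith+
  have "a \<noteq> b" using label_near[OF _ near(1), of x] b(2) abc by auto
  moreover have "a \<noteq> c" using label_near[OF _ near(2), of x] b(5) abc by auto
  moreover have "b \<noteq> c" using label_near[OF _ near(3), of x] b(3) abc by auto
  ultimately show ?thesis by simp
qed

lemma positive_simplex:
  assumes "positive \<rho> a b c" shows "{a, b, c} \<in> cyclic_torus \<rho>"
proof -
  obtain x i where i: "i \<in> link" and abc: "a = \<rho> x" "b = \<rho> (x + i)" "c = \<rho> (x + turn i)"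
    using assms by (auto simp: positive_def)
  from i show ?thesis
  proof (cases rule: link_cases)
    case 1 then show ?thesis using triangles_in_torus(1)[of x] by (simp add: abc)
  next
    case 2 then show ?thesis using triangles_in_torus(2)[of x] by (simp add: abc insert_commute add.commute)
  next
    case 3 then show ?thesis using triangles_in_torus(1)[of "x - 1"] by (simp add: abc insert_commute add.commute)
  next
    case 4 then show ?thesis using triangles_in_torus(2)[of "x - 3"] by (simp add: abc insert_commute add.commute)
  next
    case 5 then show ?thesis using triangles_in_torus(1)[of "x - 3"] by (simp add: abc insert_commute add.commute)
  next
    case 6 then show ?thesis using triangles_in_torus(2)[of "x - 2"] by (simp add: abc insert_commute add.commute)
  qed
qed

lemma ordered_triangle:
  assumes d: "distinct [a, b, c]" and t: "{a, b, c} \<in> cyclic_torus \<rho>"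
  shows "positive \<rho> a b c \<or> positive \<rho> a c b"
proof -
  have perms: "positive \<rho> a b c \<or> positive \<rho> a c b"
    if "positive \<rho> p q r" "{a, b, c} \<subseteq> {p, q, r}" for p q r
  proof -
    have rot: "positive \<rho> q r p" "positive \<rho> r p q" by (fact positive_rotate[OF that(1)], fact positive_rotate[OF positive_rotate[OF that(1)]])
    have "a = p \<or> a = q \<or> a = r" "b = p \<or> b = q \<or> b = r" "c = p \<or> c = q \<or> c = r"
      using that(2) by simp_all
    then show ?thesis
      using d by (elim disjE) (simp_all add: that(1) rot)
  qed
  obtain x where "{a, b, c} \<subseteq> {\<rho> x, \<rho> (x + 1), \<rho> (x + 3)} \<or> {a, b, c} \<subseteq> {\<rho> x, \<rho> (x + 3), \<rho> (x + 2)}"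
    using t unfolding cyclic_torus_def by blast
  then show ?thesis
    using perms[OF positive_link[of 1 x, simplified]] perms[OF positive_link[of 3 x, simplified]] by blast
qed

lemma positive_unique:
  assumes "positive \<rho> a b c" "positive \<rho> a b c'" shows "c = c'"
proof -
  obtain x i where i: "i \<in> link" and abc: "a = \<rho> x" "b = \<rho> (x + i)" "c = \<rho> (x + turn i)"
    using assms(1) by (auto simp: positive_def)
  obtain y j where j: "j \<in> link" and abc': "a = \<rho> y" "b = \<rho> (y + j)" "c' = \<rho> (y + turn j)"
    using assms(2) by (auto simp: positive_def)
  have xy: "n dvd x - y" using abc(1) abc'(1) label_eq[of x y] by simp
  then have "\<rho> (x + j) = \<rho> (y + j)" by (simp add: label_eq)
  then have "i = j"
    using abc(2) abc'(2) label_near[of x i j] link_turn(6)[OF i] link_turn(6)[OF j] by simp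
  then show ?thesis using xy abc(3) abc'(3) label_eq[of "x + turn i" "y + turn i"] by simp
qed

lemma positive_exclusive: "positive \<rho> a b c \<Longrightarrow> \<not> positive \<rho> a c b"
proof
  assume "positive \<rho> a b c" and acb: "positive \<rho> a c b"
  then obtain x i where i: "i \<in> link" and abc: "a = \<rho> x" "b = \<rho> (x + i)" "c = \<rho> (x + turn i)"
    by (auto simp: positive_def)
  have "positive \<rho> a c (\<rho> (x + turn (turn i)))"
    using positive_link[OF link_turn(1)[OF i], of x] abc by simp
  then have "\<rho> (x + turn (turn i)) = \<rho> (x + i)" using positive_unique acb abc(2) by blast
  moreover have "\<bar>turn (turn i)\<bar> \<le> 3" "\<bar>i\<bar> \<le> 3"
    using link_turn(6) link_turn(1) i by blast+
  ultimately have "turn (turn i) = i" using label_near[of x "turn (turn i)" i] by simp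
  then show False using link_turn(5)[OF i] by simp
qed

lemma positive_opposite:
  assumes "positive \<rho> a b c" obtains c' where "positive \<rho> b a c'"
proof -
  obtain x i where i: "i \<in> link" and abc: "a = \<rho> x" "b = \<rho> (x + i)"
    using assms by (auto simp: positive_def)
  show thesis
    using that positive_link[OF link_turn(3)[OF i], of "x + i"] abc by simp
qed

lemma positive_range: "positive \<rho> a b c \<Longrightarrow> a \<in> range \<rho> \<and> b \<in> range \<rho> \<and> c \<in> range \<rho>"
  by (auto simp: positive_def)

lemma torus_cycle_support:
  assumes "torus_cycle \<rho> s \<noteq> 0"
  shows "length s = 3 \<and> distinct s \<and> set s \<in> cyclic_torus \<rho>"
proof -
  obtain a b c where s: "s = [a, b, c]"
    using assms by (auto simp: torus_cycle_def split: list.splits)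
  then have "positive \<rho> a b c \<or> positive \<rho> a c b"
    using assms by (auto simp: torus_cycle_triple)
  then show ?thesis
  proof
    assume "positive \<rho> a b c"
    then show ?thesis using positive_distinct[of a b c] positive_simplex[of a b c] by (simp add: s)
  next
    assume "positive \<rho> a c b"
    then show ?thesis using positive_distinct[of a c b] positive_simplex[of a c b]
      by (auto simp: s insert_commute)
  qed
qed

lemma sum_positive:
  "(\<Sum>v\<in>range \<rho>. of_bool (positive \<rho> a b v)) = (of_bool (\<exists>v. positive \<rho> a b v) :: int)"
proof (cases "\<exists>v. positive \<rho> a b v")
  case True
  then obtain u where u: "positive \<rho> a b u" by blast
  then have "positive \<rho> a b v \<longleftrightarrow> v = u" for v using positive_unique by blast
  then have "(\<Sum>v\<in>range \<rho>. of_bool (positive \<rho> a b v)) = (\<Sum>v\<in>range \<rho>. if v = u then 1 else 0 :: int)"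
    by (intro sum.cong) auto
  also have "\<dots> = 1" using finite_range_label positive_range[OF u] by (simp add: sum.delta)
  finally show ?thesis using True by simp
qed simp

lemma torus_cycle_in_two_cycles: "torus_cycle \<rho> \<in> two_cycles (cyclic_torus \<rho>)"
proof (rule two_cyclesI)
  show "(\<Sum>v\<in>vertices (cyclic_torus \<rho>). torus_cycle \<rho> (v # s)) = 0" for s
  proof (cases "length s = 2")
    case True
    then obtain a b where s: "s = [a, b]" by (auto simp: numeral_2_eq_2 length_Suc_conv)
    have "(\<exists>v. positive \<rho> a b v) \<longleftrightarrow> (\<exists>v. positive \<rho> b a v)"
      using positive_opposite by metis
    moreover have "torus_cycle \<rho> (v # s) = of_bool (positive \<rho> a b v) - of_bool (positive \<rho> b a v)" for v
      using positive_rotate_iff[of \<rho> a b v] positive_rotate_iff[of \<rho> b a v]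
      by (simp only: s torus_cycle_triple)
    ultimately show ?thesis
      by (simp only: vertices_torus sum_subtractf sum_positive)
  next
    case False
    then have "torus_cycle \<rho> (v # s) = 0" for v
      using torus_cycle_support[of "v # s"] by auto
    then show ?thesis by simp
  qed
qed (erule torus_cycle_support | rule torus_cycle_alternating)+

lemma torus_cycle_value:
  assumes "distinct [a, b, c]" "{a, b, c} \<in> cyclic_torus \<rho>"
  shows "torus_cycle \<rho> [a, b, c] = (if positive \<rho> a b c then 1 else - 1)"
  using ordered_triangle[OF assms] positive_exclusive[of a b c] by (auto simp: torus_cycle_triple)

text \<open>
  The coefficients of a cycle on the two triangles at an edge agree up to orientation. Going around a vertex,
  all six triangles there have the same coefficient \<open>u x\<close>; since the vertices \<open>x\<close> and \<open>x + 1\<close> share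
  a triangle, \<open>u\<close> is constant.
\<close>

lemma two_cycles_torus_multiple:
  assumes z: "z \<in> two_cycles (cyclic_torus \<rho>)"
  shows "\<exists>m::int. z = (\<lambda>s. m * torus_cycle \<rho> s)"
proof -
  define u where "u x i = z [\<rho> x, \<rho> (x + i), \<rho> (x + turn i)]" for x i
  have rot: "u x i = u (x + i) (turn i - i)" if "i \<in> link" for x i
    using two_cycles_alternating(3)[OF z, of "\<rho> x" "\<rho> (x + i)" "\<rho> (x + turn i)"] link_turn(4)[OF that]
    by (simp add: u_def)
  have edge: "u x i = u (x + i) (- i)" if i: "i \<in> link" for x i
  proof -
    define a b c c' where "a = \<rho> x" and "b = \<rho> (x + i)" and "c = \<rho> (x + turn i)"
      and "c' = \<rho> (x + i + turn (- i))"
    have c: "positive \<rho> a b c" unfolding a_def b_def c_def using positive_link[OF i] .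
    have c': "positive \<rho> b a c'"
      unfolding a_def b_def c'_def using positive_link[OF link_turn(3)[OF i], of "x + i"] by simp
    have ne: "c \<noteq> c'" using c c' positive_exclusive[of b c a] positive_rotate_iff[of \<rho> b c a] by blast
    have "z [v, a, b] = 0" if "v \<notin> {c, c'}" for v
    proof (rule ccontr)
      assume "z [v, a, b] \<noteq> 0"
      from two_cycles_support[OF z this] have "positive \<rho> v a b \<or> positive \<rho> v b a"
        by (intro ordered_triangle) simp_all
      then have "positive \<rho> a b v \<or> positive \<rho> b a v"
        using positive_rotate_iff[of \<rho> a b v] positive_rotate_iff[of \<rho> b a v] by blast
      then show False using that c c' positive_unique by blast
    qed
    then have "(\<Sum>v\<in>range \<rho>. z [v, a, b]) = (\<Sum>v\<in>{c, c'}. z [v, a, b])"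
      using finite_range_label positive_range[OF c] positive_range[OF c']
      by (intro sum.mono_neutral_right) auto
    moreover have "(\<Sum>v\<in>range \<rho>. z [v, a, b]) = 0"
      using z unfolding two_cycles_def vertices_torus by blast
    ultimately have "z [c, a, b] + z [c', a, b] = 0" using ne by simp
    moreover have "z [c, a, b] = z [a, b, c]" "z [c', a, b] = - z [b, a, c']"
      using two_cycles_alternating(3)[OF z, of c a b] two_cycles_alternating(5)[OF z, of c' a b] by simp_all
    ultimately show ?thesis by (simp add: u_def a_def b_def c_def c'_def)
  qed
  have next_eq: "u x i = u x (turn i)" if i: "i \<in> link" for x i
  proof -
    \<comment> \<open>Both rules are applied to the edge from \<open>x + turn i\<close> back to \<open>x\<close>.\<close>
    have "- turn i \<in> link" using link_turn(3)[OF link_turn(1)[OF i]] .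
    from rot[OF this, of "x + turn i"] edge[OF this, of "x + turn i"] link_turn(9)[OF i]
    show ?thesis by simp
  qed
  have all_eq: "u x i = u x 1" if "i \<in> link" for x i
    using that next_eq[of 1 x] next_eq[of 3 x] next_eq[of 2 x] next_eq[of "-1" x] next_eq[of "-3" x]
    by (cases rule: link_cases) simp_all
  have step: "u (x + 1) 1 = u x 1" for x
    using edge[of 1 x] all_eq[of "-1" "x + 1"] by simp
  define m where "m = u 0 1"
  have const: "u x 1 = m" for x
  proof (induction x rule: int_induct[of _ 0])
    case base then show ?case by (simp add: m_def)
  next
    case (step1 i) then show ?case using step by simp
  next
    case (step2 i) then show ?case using step[of "i - 1"] by simp
  qed
  have pos: "z [a, b, c] = m" if "positive \<rho> a b c" for a b c
    using that all_eq const unfolding positive_def u_def by metis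
  have "z s = m * torus_cycle \<rho> s" for s
  proof (cases "z s = 0 \<and> torus_cycle \<rho> s = 0")
    case False
    then have s3: "length s = 3" "distinct s" "set s \<in> cyclic_torus \<rho>"
      using two_cycles_support[OF z, of s] torus_cycle_support[of s] by blast+
    then obtain a b c where s: "s = [a, b, c]" by (auto simp: numeral_3_eq_3 length_Suc_conv)
    then have "positive \<rho> a b c \<or> positive \<rho> a c b" using s3 by (intro ordered_triangle) simp_all
    then show ?thesis
      using pos[of a b c] pos[of a c b] two_cycles_alternating(2)[OF z, of a b c]
        positive_exclusive[of a b c]
      by (auto simp: s torus_cycle_triple)
  qed simp
  then show ?thesis by blast
qed

lemma surface_complex_torus: "surface_complex (cyclic_torus \<rho>) (torus_cycle \<rho>)"
  unfolding surface_complex_def fundamental_cycle_def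
proof (intro conjI ballI)
  show "\<exists>s. torus_cycle \<rho> s \<noteq> 0"
    using positive_link[of 1 0] positive_exclusive by (auto simp: torus_cycle_triple intro!: exI[of _ "[\<rho> 0, \<rho> 1, \<rho> 3]"])
  show "\<bar>torus_cycle \<rho> s\<bar> = 1" if "s \<in> ordered_simplices 2 (cyclic_torus \<rho>)" for s
  proof -
    have "length s = 3" using that by (simp add: ordered_simplices_def)
    then obtain a b c where "s = [a, b, c]" by (auto simp: numeral_3_eq_3 length_Suc_conv)
    then show ?thesis using that torus_cycle_value[of a b c] by (simp add: ordered_simplices_def)
  qed
qed (use finite_simplicial_complex_torus dim_torus torus_cycle_in_two_cycles two_cycles_torus_multiple in blast)+

end

section \<open>Relabelling, and the 7-vertex torus\<close>

text \<open>
  Labellings with the same \<open>n\<close> give isomorphic oriented complexes; this is the degree 1 map of the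
  construction.
\<close>

lemma relabel_torus:
  assumes "cyclic_labelling n \<rho>" and "cyclic_labelling n \<rho>'" and f: "\<And>x. f (\<rho> x) = \<rho>' x"
  shows simplicial_map_relabel: "simplicial_map (cyclic_torus \<rho>) (cyclic_torus \<rho>') f"
    and chain_map_relabel: "chain_map 2 (cyclic_torus \<rho>) f (torus_cycle \<rho>) = torus_cycle \<rho>'"
proof -
  interpret R: cyclic_labelling n \<rho> by fact
  interpret R': cyclic_labelling n \<rho>' by fact
  have eq: "\<rho>' x = \<rho>' y \<longleftrightarrow> \<rho> x = \<rho> y" for x y by (simp add: R.label_eq R'.label_eq)
  show "simplicial_map (cyclic_torus \<rho>) (cyclic_torus \<rho>') f"
    unfolding simplicial_map_def
  proof
    fix \<sigma> assume "\<sigma> \<in> cyclic_torus \<rho>"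
    then obtain x where "\<sigma> \<noteq> {}"
      "\<sigma> \<subseteq> {\<rho> x, \<rho> (x + 1), \<rho> (x + 3)} \<or> \<sigma> \<subseteq> {\<rho> x, \<rho> (x + 2), \<rho> (x + 3)}"
      unfolding cyclic_torus_def by blast
    then have "f ` \<sigma> \<noteq> {}"
      "f ` \<sigma> \<subseteq> {\<rho>' x, \<rho>' (x + 1), \<rho>' (x + 3)} \<or> f ` \<sigma> \<subseteq> {\<rho>' x, \<rho>' (x + 2), \<rho>' (x + 3)}"
      using f by (blast, fastforce)
    then show "f ` \<sigma> \<in> cyclic_torus \<rho>'" unfolding cyclic_torus_def by blast
  qed
  have pos: "positive \<rho>' (\<rho>' a) (\<rho>' b) (\<rho>' c) \<longleftrightarrow> positive \<rho> (\<rho> a) (\<rho> b) (\<rho> c)" for a b c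
    unfolding positive_def eq ..
  show "chain_map 2 (cyclic_torus \<rho>) f (torus_cycle \<rho>) = torus_cycle \<rho>'"
  proof (rule chain_map_inj)
    show "torus_cycle \<rho> \<in> two_cycles (cyclic_torus \<rho>)" by (rule R.torus_cycle_in_two_cycles)
    show "finite (vertices (cyclic_torus \<rho>))" by (simp add: R.vertices_torus R.finite_range_label)
    show "inj_on f (vertices (cyclic_torus \<rho>))"
      unfolding R.vertices_torus by (auto simp: inj_on_def f eq)
    show "torus_cycle \<rho>' (map f t) = torus_cycle \<rho> t" if t: "set t \<subseteq> vertices (cyclic_torus \<rho>)" for t
    proof (cases "length t = 3")
      case True
      then obtain a b c where "t = [\<rho> a, \<rho> b, \<rho> c]"
        using t by (auto simp: numeral_3_eq_3 length_Suc_conv R.vertices_torus)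
      then show ?thesis by (simp add: torus_cycle_triple f pos)
    next
      case False
      then have "torus_cycle \<rho>' (map f t) = 0" "torus_cycle \<rho> t = 0"
        using R.torus_cycle_support[of t] R'.torus_cycle_support[of "map f t"] by auto
      then show ?thesis by simp
    qed
    show "distinct s \<and> set s \<subseteq> f ` vertices (cyclic_torus \<rho>)" if "torus_cycle \<rho>' s \<noteq> 0" for s
    proof -
      have "range \<rho>' = f ` range \<rho>" using f by (simp add: image_image)
      moreover have "set s \<subseteq> vertices (cyclic_torus \<rho>')" using R'.torus_cycle_support[OF that] by blast
      ultimately show ?thesis using R'.torus_cycle_support[OF that]
        by (simp add: R.vertices_torus R'.vertices_torus)
    qed
  qed
qed

text \<open>
  The vertices of the given 7-vertex torus are numbered from 1 to 7, with 7 in the place of 0.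
\<close>

definition label7 :: "int \<Rightarrow> nat" where "label7 x = nat ((x - 1) mod 7) + 1"

lemma cyclic_labelling_7: "cyclic_labelling 7 label7"
proof
  show "label7 x = label7 y \<longleftrightarrow> 7 dvd x - y" for x y
  proof -
    have "label7 x = label7 y \<longleftrightarrow> (x - 1) mod 7 = (y - 1) mod 7"
      by (simp add: label7_def eq_nat_nat_iff)
    also have "\<dots> \<longleftrightarrow> 7 dvd x - y" by (simp add: mod_eq_dvd_iff)
    finally show ?thesis .
  qed
qed simp

interpretation T7: cyclic_labelling 7 label7 by (rule cyclic_labelling_7)

lemma torus7_eq: "torus7 = cyclic_torus label7"
proof -
  have shift: "label7 (x + i) = label7 (x mod 7 + i)" for x i
    by (simp add: T7.label_eq mod_eq_dvd_iff[symmetric])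
  have shift0: "label7 x = label7 (x mod 7)" for x using shift[of x 0] by simp
  have up_mod: "\<forall>r\<in>{0,1,2,3,4,5,6}. {label7 r, label7 (r + 1), label7 (r + 3)} \<in> torus7_triangles
      \<and> {label7 r, label7 (r + 2), label7 (r + 3)} \<in> torus7_triangles"
    by code_simp
  have up: "{label7 x, label7 (x + 1), label7 (x + 3)} \<in> torus7_triangles
      \<and> {label7 x, label7 (x + 2), label7 (x + 3)} \<in> torus7_triangles" for x
  proof -
    have "0 \<le> x mod 7" "x mod 7 < 7" by simp_all
    then have "x mod 7 \<in> {0,1,2,3,4,5,6}" by (simp only: insert_iff empty_iff) linarith
    from bspec[OF up_mod this] show ?thesis
      by (simp only: shift0[of x, symmetric] shift[of x, symmetric])
  qed
  have "\<forall>\<tau>\<in>torus7_triangles. \<exists>x\<in>{1,2,3,4,5,6,7}.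
      \<tau> = {label7 x, label7 (x + 1), label7 (x + 3)} \<or> \<tau> = {label7 x, label7 (x + 2), label7 (x + 3)}"
    by code_simp
  then have tri: "\<exists>x. \<tau> = {label7 x, label7 (x + 1), label7 (x + 3)} \<or> \<tau> = {label7 x, label7 (x + 2), label7 (x + 3)}"
    if "\<tau> \<in> torus7_triangles" for \<tau>
    using that by meson
  show ?thesis
    unfolding torus7_def cyclic_torus_def using up tri by (intro Collect_cong) metis
qed

lemma label7_124: "label7 1 = 1" "label7 2 = 2" "label7 4 = 4"
  by (simp_all add: label7_def)

lemma torus_cycle_124: "torus_cycle label7 [1, 2, 4] = 1"
proof -
  have "positive label7 1 2 4" using T7.positive_link[of 1 1] label7_124 by simp
  then show ?thesis using T7.positive_exclusive[of 1 2 4] by (simp add: torus_cycle_triple)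
qed

lemma fundamental_class_surface_complex:
  assumes "surface_complex K c" shows "fundamental_class K {c}"
  using assms by (intro fundamental_class_if_generator) (auto simp: surface_complex_def fundamental_cycle_def)

lemma torus7_class_eq: "torus7_class = {torus_cycle label7}"
  unfolding torus7_class_def
proof (rule the_equality)
  show "fundamental_class torus7 {torus_cycle label7} \<and> positively_oriented {torus_cycle label7} [1, 2, 4]"
    using fundamental_class_surface_complex[OF T7.surface_complex_torus] torus_cycle_124
    by (simp add: torus7_eq positively_oriented_def)
next
  fix \<beta> assume \<beta>: "fundamental_class torus7 \<beta> \<and> positively_oriented \<beta> [1, 2, 4]"
  then obtain b where b: "\<beta> = {b}" "b \<in> two_cycles torus7"
    using fundamental_class_generatorE[of torus7 \<beta>] T7.dim_torus unfolding torus7_eq by metis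
  then obtain m :: int where "b = (\<lambda>s. m * torus_cycle label7 s)"
    using T7.two_cycles_torus_multiple unfolding torus7_eq by blast
  moreover have "b [1, 2, 4] = 1" using \<beta> b by (simp add: positively_oriented_def)
  ultimately show "\<beta> = {torus_cycle label7}" using b(1) torus_cycle_124 by simp
qed

section \<open>Gluing along a triangle: the carrier\<close>

definition closed_simplex :: "'v set \<Rightarrow> ('v \<Rightarrow> real) set" where
  "closed_simplex \<sigma> = {x. (\<forall>v. 0 \<le> x v) \<and> (\<forall>v. v \<notin> \<sigma> \<longrightarrow> x v = 0) \<and> (\<Sum>v\<in>\<sigma>. x v) = 1}"

text \<open>
  For a face of a larger complex the natural sum is over \<open>\<sigma>\<close>, while carriers are described by sums over
  the support.
\<close>

lemma closed_simplex_support: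
  assumes "finite \<sigma>"
  shows "x \<in> closed_simplex \<sigma> \<longleftrightarrow>
    (\<forall>v. 0 \<le> x v) \<and> {v. x v \<noteq> 0} \<subseteq> \<sigma> \<and> (\<Sum>v | x v \<noteq> 0. x v) = 1"
proof -
  have "(\<Sum>v\<in>\<sigma>. x v) = (\<Sum>v | x v \<noteq> 0. x v)" if "{v. x v \<noteq> 0} \<subseteq> \<sigma>"
    using assms that by (intro sum.mono_neutral_right) auto
  moreover have "(\<forall>v. v \<notin> \<sigma> \<longrightarrow> x v = 0) \<longleftrightarrow> {v. x v \<noteq> 0} \<subseteq> \<sigma>" by blast
  ultimately show ?thesis unfolding closed_simplex_def by fastforce
qed

lemma closed_closed_simplex: "closed (closed_simplex \<sigma>)"
proof -
  have coord: "continuous_on UNIV (\<lambda>x::'a \<Rightarrow> real. x v)" for v by simp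
  show ?thesis
    unfolding closed_simplex_def
    by (intro closed_Collect_conj closed_Collect_all closed_Collect_imp open_Collect_const
        closed_Collect_le closed_Collect_eq continuous_on_sum continuous_on_const coord)
qed

lemma compact_closed_simplex:
  assumes "finite \<sigma>" shows "compact (closed_simplex \<sigma>)"
proof -
  let ?B = "PiE UNIV (\<lambda>_. {0..1}) :: ('a \<Rightarrow> real) set"
  have "compactin (product_topology (\<lambda>_. euclideanreal) UNIV) ?B"
    by (simp add: compactin_PiE)
  then have B: "compact ?B" by (simp only: euclidean_product_topology compactin_euclidean_iff)
  have "closed_simplex \<sigma> \<subseteq> ?B"
  proof
    fix x assume x: "x \<in> closed_simplex \<sigma>"
    have "x v \<le> 1" for v
    proof (cases "v \<in> \<sigma>")
      case True
      then have "x v \<le> (\<Sum>v\<in>\<sigma>. x v)"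
        using x assms by (intro member_le_sum) (auto simp: closed_simplex_def)
      then show ?thesis using x by (simp add: closed_simplex_def)
    qed (use x in \<open>simp add: closed_simplex_def\<close>)
    then show "x \<in> ?B" using x by (simp add: closed_simplex_def PiE_UNIV_domain Pi_def)
  qed
  then show ?thesis using B closed_closed_simplex by (metis compact_Int_closed inf.absorb_iff2)
qed

lemma carrier_eq_Union_simplices:
  assumes "finite_simplicial_complex K"
  shows "geometric_carrier K = (\<Union>\<sigma>\<in>K. closed_simplex \<sigma>)"
proof (rule Set.set_eqI)
  fix x :: "'a \<Rightarrow> real"
  have fin: "finite \<sigma>" if "\<sigma> \<in> K" for \<sigma>
    using assms that unfolding finite_simplicial_complex_def by blast
  show "x \<in> geometric_carrier K \<longleftrightarrow> x \<in> (\<Union>\<sigma>\<in>K. closed_simplex \<sigma>)"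
  proof
    assume "x \<in> geometric_carrier K"
    then have "{v. x v \<noteq> 0} \<in> K" "x \<in> closed_simplex {v. x v \<noteq> 0}"
      using closed_simplex_support fin unfolding geometric_carrier_def by blast+
    then show "x \<in> (\<Union>\<sigma>\<in>K. closed_simplex \<sigma>)" by blast
  next
    assume "x \<in> (\<Union>\<sigma>\<in>K. closed_simplex \<sigma>)"
    then obtain \<sigma> where \<sigma>: "\<sigma> \<in> K" "x \<in> closed_simplex \<sigma>" by blast
    then have x: "\<forall>v. 0 \<le> x v" "{v. x v \<noteq> 0} \<subseteq> \<sigma>" "(\<Sum>v | x v \<noteq> 0. x v) = 1"
      using closed_simplex_support[OF fin] by blast+
    then have "{v. x v \<noteq> 0} \<noteq> {}" by (metis sum.empty zero_neq_one)
    then have "{v. x v \<noteq> 0} \<in> K" using face_in_complex[OF assms \<sigma>(1) x(2)] by blast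
    then show "x \<in> geometric_carrier K" using x unfolding geometric_carrier_def by blast
  qed
qed

lemma compact_carrier:
  assumes "finite_simplicial_complex K" shows "compact (geometric_carrier K)"
  unfolding carrier_eq_Union_simplices[OF assms]
  using assms unfolding finite_simplicial_complex_def
  by (intro compact_UN compact_closed_simplex) auto

lemma closed_carrier:
  assumes "finite_simplicial_complex K" shows "closed (geometric_carrier K)"
  unfolding carrier_eq_Union_simplices[OF assms]
  using assms unfolding finite_simplicial_complex_def
  by (intro closed_UN ballI closed_closed_simplex) blast

lemma carrier_minus_simplex:
  "geometric_carrier (K - {\<sigma>}) = geometric_carrier K - {x. {v. x v \<noteq> 0} = \<sigma>}"
  unfolding geometric_carrier_def by blast

text \<open>
  Compact convex sets with interior points are homeomorphic to the disc, and by invariance of domain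
  any such homeomorphism matches the interiors.
\<close>

lemma disc_onto_plane_triangle:
  obtains h g where "homeomorphism (cball (0::complex) 1) {z::complex. 0 \<le> Re z \<and> 0 \<le> Im z \<and> Re z + Im z \<le> 1} h g"
    and "h ` ball 0 1 = {z. 0 < Re z \<and> 0 < Im z \<and> Re z + Im z < 1}"
proof -
  let ?C = "{z::complex. 0 \<le> Re z \<and> 0 \<le> Im z \<and> Re z + Im z \<le> 1}"
  let ?O = "{z::complex. 0 < Re z \<and> 0 < Im z \<and> Re z + Im z < 1}"
  have C: "?C = {z. (1::complex) \<bullet> z \<ge> 0} \<inter> {z. \<i> \<bullet> z \<ge> 0} \<inter> {z. (1 + \<i>) \<bullet> z \<le> 1}"
    by (auto simp: inner_complex_def)
  have int: "interior ?C = ?O"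
    unfolding C interior_Int
    by (subst interior_halfspace_ge interior_halfspace_le, simp add: complex_eq_iff)+
      (auto simp: inner_complex_def)
  have "convex ?C" unfolding C by (intro convex_Int convex_halfspace_ge convex_halfspace_le)
  moreover have "compact ?C"
  proof -
    have "closed ?C" unfolding C by (intro closed_Int closed_halfspace_ge closed_halfspace_le)
    moreover have "?C \<subseteq> cball 0 1"
    proof
      fix z assume "z \<in> ?C"
      then show "z \<in> cball 0 1" using cmod_le[of z] by auto
    qed
    ultimately show ?thesis by (meson bounded_cball bounded_subset compact_eq_bounded_closed)
  qed
  moreover have "Complex (1/3) (1/3) \<in> interior ?C" unfolding int by simp
  ultimately have "?C homeomorphic cball (0::complex) 1"
    by (intro homeomorphic_convex_compact_cball) auto
  then have "cball (0::complex) 1 homeomorphic ?C" by (rule homeomorphic_sym[THEN iffD1])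
  then obtain h g where hg: "homeomorphism (cball (0::complex) 1) ?C h g"
    unfolding homeomorphic_def by blast
  note hg' = homeomorphism_image1[OF hg] homeomorphism_image2[OF hg] homeomorphism_cont1[OF hg]
    homeomorphism_cont2[OF hg] homeomorphism_apply1[OF hg] homeomorphism_apply2[OF hg]
  have inj: "inj_on h (cball 0 1)" "inj_on g ?C" by (rule inj_on_inverseI, erule hg'(5), rule inj_on_inverseI, erule hg'(6))
  have "h \<in> interior (cball 0 1) \<rightarrow> interior (h ` cball 0 1)"
    using hg'(3) inj(1) by (rule continuous_image_subset_interior) simp
  then have 1: "h z \<in> ?O" if "z \<in> ball 0 1" for z
    using that unfolding hg'(1) int interior_cball by blast
  have "g \<in> interior ?C \<rightarrow> interior (g ` ?C)"
    using hg'(4) inj(2) by (rule continuous_image_subset_interior) simp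
  then have 2: "g z \<in> ball 0 1" if "z \<in> ?O" for z
    using that unfolding hg'(2) int interior_cball by blast
  have "h ` ball 0 1 = ?O"
  proof
    show "?O \<subseteq> h ` ball 0 1"
    proof
      fix z assume z: "z \<in> ?O"
      then have "h (g z) = z" using hg'(6) by simp
      then show "z \<in> h ` ball 0 1" using 2[OF z] by (metis image_eqI)
    qed
  qed (use 1 in blast)
  then show thesis using that hg by blast
qed

lemma disc_onto_closed_simplex:
  assumes d: "distinct [a, b, c]"
  obtains h g where "homeomorphism (cball (0::complex) 1) (closed_simplex {a, b, c}) h g"
    and "h ` ball 0 1 = {x \<in> closed_simplex {a, b, c}. {v. x v \<noteq> 0} = {a, b, c}}"
proof -
  let ?C = "{z::complex. 0 \<le> Re z \<and> 0 \<le> Im z \<and> Re z + Im z \<le> 1}"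
  let ?O = "{z::complex. 0 < Re z \<and> 0 < Im z \<and> Re z + Im z < 1}"
  obtain h g where hg: "homeomorphism (cball (0::complex) 1) ?C h g" and hO: "h ` ball 0 1 = ?O"
    using disc_onto_plane_triangle by blast
  define \<beta> where "\<beta> z = (\<lambda>v. if v = a then Re z else if v = b then Im z else if v = c then 1 - Re z - Im z else 0)" for z
  define \<gamma> where "\<gamma> x = Complex (x a) (x b)" for x :: "'a \<Rightarrow> real"
  have cont: "continuous_on ?C \<beta>"
  proof (rule continuous_on_coordinatewise_then_product)
    fix v show "continuous_on ?C (\<lambda>z. \<beta> z v)"
      unfolding \<beta>_def by (cases "v = a"; cases "v = b"; cases "v = c"; simp; intro continuous_intros)
  qed
  have coord: "continuous_on S (\<lambda>x::'a \<Rightarrow> real. x v)" for v S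
    by (rule continuous_on_subset[OF continuous_on_product_coordinates]) simp
  have cont': "continuous_on (closed_simplex {a, b, c}) \<gamma>"
    unfolding \<gamma>_def Complex_eq by (intro continuous_intros coord)
  have \<beta>C: "\<beta> z \<in> closed_simplex {a, b, c}" if "z \<in> ?C" for z
    using that d by (auto simp: \<beta>_def closed_simplex_def)
  have \<gamma>C: "\<gamma> x \<in> ?C \<and> \<beta> (\<gamma> x) = x" if "x \<in> closed_simplex {a, b, c}" for x
  proof -
    have zero: "x v = 0" if "v \<noteq> a" "v \<noteq> b" "v \<noteq> c" for v
      using \<open>x \<in> closed_simplex {a, b, c}\<close> that by (simp add: closed_simplex_def)
    have nonneg: "0 \<le> x a" "0 \<le> x b" "0 \<le> x c" and sum: "x a + x b + x c = 1"
      using that d by (simp_all add: closed_simplex_def)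
    then have "\<gamma> x \<in> ?C" by (simp add: \<gamma>_def)
    moreover have "\<beta> (\<gamma> x) = x"
      unfolding fun_eq_iff using sum zero by (simp add: \<beta>_def \<gamma>_def)
    ultimately show ?thesis ..
  qed
  have \<gamma>\<beta>: "\<gamma> (\<beta> z) = z" for z using d by (auto simp: \<beta>_def \<gamma>_def)
  have \<beta>: "homeomorphism ?C (closed_simplex {a, b, c}) \<beta> \<gamma>"
    using cont cont' \<beta>C \<gamma>C \<gamma>\<beta> by (intro homeomorphismI) auto
  have "\<beta> ` ?O = {x \<in> closed_simplex {a, b, c}. {v. x v \<noteq> 0} = {a, b, c}}" (is "_ = ?R")
  proof
    show "\<beta> ` ?O \<subseteq> ?R"
    proof
      fix x assume "x \<in> \<beta> ` ?O"
      then obtain z where z: "z \<in> ?O" "x = \<beta> z" by blast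
      have "{v. \<beta> z v \<noteq> 0} = {a, b, c}" using z(1) d by (auto simp: \<beta>_def)
      then show "x \<in> ?R" using z \<beta>C[of z] by auto
    qed
    show "?R \<subseteq> \<beta> ` ?O"
    proof
      fix x assume x: "x \<in> ?R"
      then have "x a \<noteq> 0" "x b \<noteq> 0" "x c \<noteq> 0" by blast+
      moreover have "0 \<le> x a" "0 \<le> x b" "0 \<le> x c" "x a + x b + x c = 1"
        using x d by (simp_all add: closed_simplex_def)
      ultimately have "\<gamma> x \<in> ?O" by (simp add: \<gamma>_def)
      then show "x \<in> \<beta> ` ?O" using \<gamma>C[of x] x by force
    qed
  qed
  then have "(\<beta> \<circ> h) ` ball 0 1 = ?R" unfolding image_comp[symmetric] hO .
  with homeomorphism_compose[OF hg \<beta>] show thesis using that by blast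
qed

lemma homeomorphism_imp_homeomorphic_maps:
  assumes "homeomorphism S T f g"
  shows "homeomorphic_maps (top_of_set S) (top_of_set T) f g"
  using homeomorphism_image1[OF assms] homeomorphism_image2[OF assms]
    homeomorphism_cont1[OF assms] homeomorphism_cont2[OF assms]
    homeomorphism_apply1[OF assms] homeomorphism_apply2[OF assms]
  unfolding homeomorphic_maps_def continuous_map_subtopology_eu topspace_euclidean_subtopology
  by blast

lemma embedding_top_of_set:
  assumes "homeomorphism S T f g" "T \<subseteq> U"
  shows "embedding_map (top_of_set S) (top_of_set U) f"
proof -
  have "subtopology (top_of_set U) (f ` S) = top_of_set T"
    using assms(2) homeomorphism_image1[OF assms(1)] by (simp add: subtopology_subtopology inf.absorb2)
  then show ?thesis
    using homeomorphism_imp_homeomorphic_maps[OF assms(1)] homeomorphic_maps_map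
    unfolding embedding_map_def topspace_euclidean_subtopology by metis
qed

context triangle_gluing
begin

lemma carrier_glued:
  "geometric_carrier glued = geometric_carrier (K - {\<sigma>}) \<union> geometric_carrier (L - {\<sigma>})"
  unfolding glued_def geometric_carrier_def by blast

lemma closed_simplex_subset: "closed_simplex \<sigma> \<subseteq> geometric_carrier K" "closed_simplex \<sigma> \<subseteq> geometric_carrier L"
  using carrier_eq_Union_simplices[OF complexes(1)] carrier_eq_Union_simplices[OF complexes(2)] \<sigma>K \<sigma>L
  by blast+

lemma in_closed_simplex_iff:
  assumes "p \<in> geometric_carrier M"
  shows "p \<in> closed_simplex \<sigma> \<longleftrightarrow> {v. p v \<noteq> 0} \<subseteq> \<sigma>"
  using assms closed_simplex_support[of \<sigma> p] \<sigma> unfolding geometric_carrier_def by auto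

text \<open>
  The carrier of \<open>glued\<close> is the union of the carriers of \<open>K\<close> and \<open>L\<close> without the open simplex \<open>\<sigma>\<close>, and these
  meet in the rim of \<open>\<sigma>\<close>. So the inclusions serve as the two embeddings of the connected sum, and one
  parametrisation \<open>h\<close> of \<open>\<sigma>\<close> by the disc serves for both summands. The homeomorphism \<open>\<phi>\<close> only transports the
  second summand to \<open>N\<close>.
\<close>

lemma connected_sum_glued:
  assumes N: "top_of_set (geometric_carrier L) homeomorphic_space N"
  shows "connected_sum (top_of_set (geometric_carrier K)) N (top_of_set (geometric_carrier glued))"
proof -
  obtain \<phi> \<psi> where \<phi>\<psi>: "homeomorphic_maps (top_of_set (geometric_carrier L)) N \<phi> \<psi>"
    using N unfolding homeomorphic_space_def by blast
  have \<phi>: "homeomorphic_map (top_of_set (geometric_carrier L)) N \<phi>"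
    and \<psi>: "homeomorphic_map N (top_of_set (geometric_carrier L)) \<psi>"
    using \<phi>\<psi> homeomorphic_maps_map by blast+
  have \<psi>\<phi>: "\<psi> (\<phi> x) = x" if "x \<in> geometric_carrier L" for x
    using \<phi>\<psi> that by (simp add: homeomorphic_maps_def)
  have \<phi>\<psi>': "\<phi> (\<psi> y) = y" if "y \<in> topspace N" for y
    using \<phi>\<psi> that by (simp add: homeomorphic_maps_def)
  have \<phi>L: "\<phi> ` geometric_carrier L = topspace N"
    using homeomorphic_imp_surjective_map[OF \<phi>] by simp
  obtain h g where hg: "homeomorphism (cball (0::complex) 1) (closed_simplex \<sigma>) h g"
    and hball: "h ` ball 0 1 = {x \<in> closed_simplex \<sigma>. {v. x v \<noteq> 0} = \<sigma>}"
    using disc_onto_closed_simplex[OF distinct] unfolding \<sigma> by blast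
  have hcball: "h ` cball 0 1 = closed_simplex \<sigma>" using hg by (simp add: homeomorphism_def)
  have hL: "h z \<in> geometric_carrier L" if "z \<in> cball 0 1" for z
    using that hcball closed_simplex_subset(2) by blast
  \<comment> \<open>The two punctured carriers; \<open>B\<close> below is the image of the second one in \<open>N\<close>.\<close>
  define A where "A = geometric_carrier (K - {\<sigma>})"
  define B' where "B' = geometric_carrier (L - {\<sigma>})"
  have open_simplex: "h ` ball 0 1 = {x. {v. x v \<noteq> 0} = \<sigma>} \<inter> geometric_carrier M" if "\<sigma> \<in> M" for M
    unfolding hball geometric_carrier_def using that closed_simplex_support[of \<sigma>] \<sigma> by auto
  have A: "geometric_carrier K - h ` ball 0 1 = A"
    unfolding open_simplex[OF \<sigma>K] A_def carrier_minus_simplex by blast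
  have B': "geometric_carrier L - h ` ball 0 1 = B'"
    unfolding open_simplex[OF \<sigma>L] B'_def carrier_minus_simplex by blast
  define B where "B = topspace N - (\<phi> \<circ> h) ` ball 0 1"
  have B: "B = \<phi> ` B'"
  proof -
    have "inj_on \<phi> (geometric_carrier L)" using \<psi>\<phi> by (rule inj_on_inverseI)
    moreover have "h ` ball 0 1 \<subseteq> geometric_carrier L" unfolding open_simplex[OF \<sigma>L] by blast
    ultimately show ?thesis
      unfolding B_def B'[symmetric] \<phi>L[symmetric] image_comp[symmetric]
      by (simp add: inj_on_image_set_diff)
  qed
  have B'L: "B' \<subseteq> geometric_carrier L" using B' by blast
  have AK: "A \<subseteq> geometric_carrier K" using A by blast
  have \<psi>B: "\<psi> ` B = B'" unfolding B image_comp using \<psi>\<phi> B'L by force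
  have BN: "B \<subseteq> topspace N" unfolding B_def by blast
  let ?G = "geometric_carrier glued"
  have G: "?G = A \<union> B'" unfolding A_def B'_def by (rule carrier_glued)
  have closed: "closedin (top_of_set ?G) A" "closedin (top_of_set ?G) B'"
    using closed_carrier[OF complex_minus(1)] closed_carrier[OF complex_minus(2)] G
    unfolding A_def[symmetric] B'_def[symmetric]
    by (auto intro!: closed_subset)
  have eK: "embedding_map (top_of_set (cball 0 1)) (top_of_set (geometric_carrier K)) h"
    by (rule embedding_top_of_set[OF hg closed_simplex_subset(1)])
  have eN: "embedding_map (top_of_set (cball 0 1)) N (\<phi> \<circ> h)"
    using embedding_top_of_set[OF hg closed_simplex_subset(2)]
  proof (rule embedding_map_compose)
    show "embedding_map (top_of_set (geometric_carrier L)) N \<phi>"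
      using \<phi> homeomorphic_imp_surjective_map[OF \<phi>] by (simp add: embedding_map_def)
  qed
  have subA: "subtopology (top_of_set (geometric_carrier K)) A = top_of_set A"
    using AK by (simp add: subtopology_subtopology inf.absorb2)
  have eA: "embedding_map (top_of_set A) (top_of_set ?G) (\<lambda>x. x)"
    using embedding_top_of_set[OF homeomorphism_ident, of A ?G] G by (simp add: id_def)
  have cA: "closed_map (top_of_set A) (top_of_set ?G) (\<lambda>x. x)"
    using closed(1) by (intro embedding_imp_closed_map[OF eA]) simp
  have eB: "embedding_map (subtopology N B) (top_of_set ?G) \<psi>"
  proof -
    have "homeomorphic_map (subtopology N B) (subtopology (top_of_set (geometric_carrier L)) B') \<psi>"
      using homeomorphic_map_subtopologies[OF \<psi>, of B B'] \<psi>B BN B'L by (simp add: inf.absorb2)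
    then have "homeomorphic_map (subtopology N B) (subtopology (top_of_set ?G) B') \<psi>"
      using B'L G by (simp add: subtopology_subtopology inf.absorb2)
    then show ?thesis using \<psi>B BN by (simp add: embedding_map_def inf.absorb2)
  qed
  have cB: "closed_map (subtopology N B) (top_of_set ?G) \<psi>"
    using closed(2) \<psi>B BN by (intro embedding_imp_closed_map[OF eB]) (simp add: inf.absorb2)
  have meet: "x = \<psi> y \<longleftrightarrow> (\<exists>z\<in>sphere 0 1. x = h z \<and> y = (\<phi> \<circ> h) z)" if x: "x \<in> A" and y: "y \<in> B" for x y
  proof
    assume xy: "x = \<psi> y"
    then have "x \<in> B'" using y \<psi>B by blast
    then have "{v. x v \<noteq> 0} \<in> K" "{v. x v \<noteq> 0} \<in> L"
      using x unfolding A_def B'_def geometric_carrier_def by blast+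
    then have "x \<in> closed_simplex \<sigma>" using in_closed_simplex_iff[of x K] x AK common_face by blast
    then obtain z where z: "z \<in> cball 0 1" "x = h z" using hcball by blast
    have "z \<notin> ball 0 1" using x z(2) A by blast
    then have "z \<in> sphere 0 1" using z(1) by auto
    moreover have "y = \<phi> x" using xy \<phi>\<psi>' y BN by auto
    ultimately show "\<exists>z\<in>sphere 0 1. x = h z \<and> y = (\<phi> \<circ> h) z" using z(2) by auto
  next
    assume "\<exists>z\<in>sphere 0 1. x = h z \<and> y = (\<phi> \<circ> h) z"
    then obtain z where "z \<in> sphere 0 1" "x = h z" "y = \<phi> (h z)" by auto
    then show "x = \<psi> y" using \<psi>\<phi> hL by auto
  qed
  have tA: "topspace (top_of_set (geometric_carrier K)) - h ` ball 0 1 = A" using A by simp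
  have cover: "topspace (top_of_set ?G) = (\<lambda>x. x) ` A \<union> \<psi> ` B" using G \<psi>B by simp
  show ?thesis
    unfolding connected_sum_def Let_def
    by (rule exI[of _ h], rule exI[of _ "\<phi> \<circ> h"], rule exI[of _ "\<lambda>x. x"], rule exI[of _ \<psi>],
        unfold tA B_def[symmetric] subA, intro conjI ballI eK eN eA cA eB cB cover meet)
qed

end

section \<open>The carrier of a cyclic torus\<close>

text \<open>
  A point \<open>(s, t)\<close> of the plane of the grid is described by \<open>y = s + 3 t\<close> and \<open>t\<close>. In these coordinates
  the lattice by which the grid is divided is \<open>n\<int> \<times> \<int>\<close>, so that this function is the quotient map onto the standard
  torus.
\<close>

definition torus_point :: "int \<Rightarrow> real \<Rightarrow> real \<Rightarrow> complex \<times> complex" where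
  "torus_point n y t = (cis (2 * pi * (y / of_int n)), cis (2 * pi * t))"

lemma cis_eq_iff: "cis (2 * pi * a) = cis (2 * pi * b) \<longleftrightarrow> (\<exists>k::int. a = b + of_int k)"
proof -
  have "cis (2 * pi * a) = cis (2 * pi * b) \<longleftrightarrow>
      sin (2 * pi * a) = sin (2 * pi * b) \<and> cos (2 * pi * a) = cos (2 * pi * b)"
    by (auto simp: complex_eq_iff)
  also have "\<dots> \<longleftrightarrow> (\<exists>k::int. 2 * pi * a = 2 * pi * b + 2 * pi * k)"
    by (rule sin_cos_eq_iff)
  also have "\<dots> \<longleftrightarrow> (\<exists>k::int. a = b + k)"
    by (intro ex_cong1) (simp flip: distrib_left)
  finally show ?thesis .
qed

lemma torus_point_eq_iff:
  assumes "n > 0"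
  shows "torus_point n y t = torus_point n y' t' \<longleftrightarrow>
    (\<exists>l k::int. y = y' + of_int (n * l) \<and> t = t' + of_int k)"
proof -
  have "y / of_int n = y' / of_int n + of_int l \<longleftrightarrow> y = y' + of_int (n * l)" for l :: int
    using assms by (simp add: field_simps)
  then show ?thesis unfolding torus_point_def prod.inject cis_eq_iff by blast
qed

lemma torus_point_surj:
  assumes "n > 0" "z \<in> sphere 0 1 \<times> sphere 0 1"
  obtains y t where "torus_point n y t = z"
proof -
  obtain p q where z: "z = (p, q)" "norm p = 1" "norm q = 1" using assms(2) by auto
  then have "p \<noteq> 0" "q \<noteq> 0" by auto
  from this[THEN cis_Arg] have "p = cis (Arg p)" "q = cis (Arg q)"
    using z by (simp_all add: sgn_div_norm)
  then have "torus_point n (of_int n * (Arg p / (2 * pi))) (Arg q / (2 * pi)) = z"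
    using assms(1) by (simp add: torus_point_def z)
  then show thesis using that by blast
qed

context cyclic_labelling
begin

text \<open>
  The point with weights \<open>1 - w1 - w2\<close>, \<open>w1\<close>, \<open>w2\<close> in the triangle with indices \<open>M\<close>, \<open>M + i\<close>, \<open>M + 3\<close>, where \<open>i\<close> is
  1 or 2 for the two kinds of triangles. Its position in the plane is given by \<open>tri_y\<close> and
  \<open>tri_t\<close>, the weighted averages of the coordinates of the lattice points.
\<close>

definition tri_point :: "int \<Rightarrow> int \<Rightarrow> real \<Rightarrow> real \<Rightarrow> 'v \<Rightarrow> real" where
  "tri_point M i w1 w2 v =
    (1 - w1 - w2) * of_bool (v = \<rho> M) + w1 * of_bool (v = \<rho> (M + i)) + w2 * of_bool (v = \<rho> (M + 3))"

text \<open>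
  Within the open star of the vertex \<open>m\<close>, placed at the lattice point \<open>(m, 0)\<close>, the position of a point is a linear
  function of its barycentric coordinates: the weighted average of the positions of the six neighbours
  and of \<open>m\<close> itself. These are its coordinates \<open>y\<close> and \<open>t\<close>.
\<close>

definition star_y :: "int \<Rightarrow> ('v \<Rightarrow> real) \<Rightarrow> real" where
  "star_y m x = of_int m + (x (\<rho> (m + 1)) - x (\<rho> (m - 1)))
    + 2 * (x (\<rho> (m + 2)) - x (\<rho> (m - 2))) + 3 * (x (\<rho> (m + 3)) - x (\<rho> (m - 3)))"

definition star_t :: "int \<Rightarrow> ('v \<Rightarrow> real) \<Rightarrow> real" where
  "star_t m x = x (\<rho> (m + 2)) + x (\<rho> (m + 3)) - x (\<rho> (m - 2)) - x (\<rho> (m - 3))"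

definition tri_y :: "int \<Rightarrow> int \<Rightarrow> real \<Rightarrow> real \<Rightarrow> real" where
  "tri_y M i w1 w2 = of_int M + of_int i * w1 + 3 * w2"

definition tri_t :: "int \<Rightarrow> real \<Rightarrow> real \<Rightarrow> real" where
  "tri_t i w1 w2 = of_bool (i = 2) * w1 + w2"

definition weights :: "int \<Rightarrow> real \<Rightarrow> real \<Rightarrow> bool" where
  "weights i w1 w2 \<longleftrightarrow> (i = 1 \<or> i = 2) \<and> 0 \<le> w1 \<and> 0 \<le> w2 \<and> w1 + w2 \<le> 1"

lemma label_offset_eq: "\<bar>i - j\<bar> \<le> 6 \<Longrightarrow> \<rho> (x + i) = \<rho> (x + j) \<longleftrightarrow> i = j"
  using label_near by blast

lemma tri_vertices_distinct:
  assumes "i = 1 \<or> i = 2" shows "distinct [\<rho> M, \<rho> (M + i), \<rho> (M + 3)]"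
  using assms label_offset_eq[of 0 i M] label_offset_eq[of 0 3 M] label_offset_eq[of i 3 M] by auto

lemma tri_point_carrier:
  assumes w: "weights i w1 w2"
  shows "tri_point M i w1 w2 \<in> geometric_carrier (cyclic_torus \<rho>)"
proof -
  have d: "distinct [\<rho> M, \<rho> (M + i), \<rho> (M + 3)]"
    using w by (intro tri_vertices_distinct) (simp add: weights_def)
  have "tri_point M i w1 w2 \<in> closed_simplex {\<rho> M, \<rho> (M + i), \<rho> (M + 3)}"
    using w d by (auto simp: closed_simplex_def tri_point_def weights_def)
  moreover have "{\<rho> M, \<rho> (M + i), \<rho> (M + 3)} \<in> cyclic_torus \<rho>"
    using w triangles_in_torus[of M] by (auto simp: weights_def)
  ultimately show ?thesis
    unfolding carrier_eq_Union_simplices[OF finite_simplicial_complex_torus] by blast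
qed

lemma carrier_tri_point:
  assumes x: "x \<in> geometric_carrier (cyclic_torus \<rho>)"
  obtains M i w1 w2 where "weights i w1 w2" "x = tri_point M i w1 w2"
proof -
  have "{v. x v \<noteq> 0} \<in> cyclic_torus \<rho>" using x unfolding geometric_carrier_def by blast
  then obtain M i where i: "i = 1 \<or> i = 2" and sub: "{v. x v \<noteq> 0} \<subseteq> {\<rho> M, \<rho> (M + i), \<rho> (M + 3)}"
    unfolding cyclic_torus_def by blast
  note d = tri_vertices_distinct[OF i, of M]
  have "x \<in> closed_simplex {\<rho> M, \<rho> (M + i), \<rho> (M + 3)}"
    using x sub closed_simplex_support[of "{\<rho> M, \<rho> (M + i), \<rho> (M + 3)}" x]
    unfolding geometric_carrier_def by blast
  then have nonneg: "\<forall>v. 0 \<le> x v" and sum: "x (\<rho> M) + x (\<rho> (M + i)) + x (\<rho> (M + 3)) = 1"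
    and zero: "\<And>v. v \<notin> {\<rho> M, \<rho> (M + i), \<rho> (M + 3)} \<Longrightarrow> x v = 0"
    using d by (auto simp: closed_simplex_def)
  have "weights i (x (\<rho> (M + i))) (x (\<rho> (M + 3)))"
  proof -
    have "0 \<le> x (\<rho> M)" using nonneg by blast
    then have "x (\<rho> (M + i)) + x (\<rho> (M + 3)) \<le> 1" using sum by linarith
    then show ?thesis using i nonneg by (simp add: weights_def)
  qed
  moreover have "x = tri_point M i (x (\<rho> (M + i))) (x (\<rho> (M + 3)))"
  proof
    fix v
    show "x v = tri_point M i (x (\<rho> (M + i))) (x (\<rho> (M + 3))) v"
    proof (cases "v \<in> {\<rho> M, \<rho> (M + i), \<rho> (M + 3)}")
      case True
      then show ?thesis using d sum by (auto simp: tri_point_def)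
    next
      case False
      then show ?thesis using zero[OF False] by (simp add: tri_point_def)
    qed
  qed
  ultimately show thesis using that by blast
qed

lemma tri_point_periodic: "tri_point (M + n * l) i w1 w2 = tri_point M i w1 w2"
proof -
  have "\<rho> (M + n * l + j) = \<rho> (M + j)" for j by (simp add: label_eq)
  from this this[of 0] show ?thesis by (simp add: tri_point_def fun_eq_iff)
qed

text \<open>
  The position of a point on the torus does not depend on the vertex from whose star it is seen: it is
  always the position in the triangle, up to the lattice.
\<close>

lemma star_tri_point:
  assumes w: "weights i w1 w2" and m: "tri_point M i w1 w2 (\<rho> m) > 0"
  shows "torus_point n (star_y m (tri_point M i w1 w2)) (star_t m (tri_point M i w1 w2))
    = torus_point n (tri_y M i w1 w2) (tri_t i w1 w2)"
proof -
  let ?x = "tri_point M i w1 w2"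
  have i: "i = 1 \<or> i = 2" using w by (simp add: weights_def)
  have "\<rho> m = \<rho> M \<or> \<rho> m = \<rho> (M + i) \<or> \<rho> m = \<rho> (M + 3)"
    using m by (auto simp: tri_point_def of_bool_def split: if_splits)
  then obtain k where k: "k = 0 \<or> k = i \<or> k = 3" and "\<rho> m = \<rho> (M + k)" by (metis add.right_neutral)
  then obtain l where l: "m = M + k + n * l" by (auto simp: label_eq dvd_def algebra_simps)
  have shift: "\<rho> (m + j) = \<rho> (M + (k + j))" for j by (simp add: label_eq l)
  \<comment> \<open>The weight of the vertex in direction \<open>j\<close> from \<open>m\<close>, which is the vertex \<open>M + k\<close> of the triangle.\<close>
  define W where "W j = (1 - w1 - w2) * of_bool (k + j = 0) + w1 * of_bool (k + j = i)
      + w2 * of_bool (k + j = 3)" for j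
  have val: "?x (\<rho> (m + j)) = W j" if j: "\<bar>j\<bar> \<le> 3" for j
  proof -
    have "0 \<le> k" "k \<le> 3" "0 \<le> i" "i \<le> 3" using i k by auto
    then have near: "\<bar>(k + j) - 0\<bar> \<le> 6" "\<bar>(k + j) - i\<bar> \<le> 6" "\<bar>(k + j) - 3\<bar> \<le> 6"
      using j by linarith+
    show ?thesis
      using label_offset_eq[OF near(1), of M] label_offset_eq[OF near(2), of M] label_offset_eq[OF near(3), of M]
      unfolding tri_point_def shift W_def by (simp only: add_0_right)
  qed
  note vals = val[of 1] val[of 2] val[of 3] val[of "-1", simplified] val[of "-2", simplified] val[of "-3", simplified]
  have "star_y m ?x = of_int m + (W 1 - W (-1)) + 2 * (W 2 - W (-2)) + 3 * (W 3 - W (-3))"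
    unfolding star_y_def by (simp add: vals)
  also have "of_int m = of_int M + of_int k + (of_int (n * l) :: real)" by (simp add: l)
  also have "of_int M + of_int k + of_int (n * l) + (W 1 - W (-1)) + 2 * (W 2 - W (-2)) + 3 * (W 3 - W (-3))
      = tri_y M i w1 w2 + of_int (n * l)"
    using i k by (elim disjE) (simp_all add: W_def tri_y_def)
  finally have "star_y m ?x = tri_y M i w1 w2 + of_int (n * l)" .
  moreover have "\<exists>c::int. star_t m ?x = tri_t i w1 w2 + of_int c"
  proof
    have "star_t m ?x = W 2 + W 3 - W (-2) - W (-3)"
      unfolding star_t_def by (simp add: vals)
    also have "\<dots> = tri_t i w1 w2 + of_int (- of_bool (k = 3 \<or> k = 2))"
      using i k by (elim disjE) (simp_all add: W_def tri_t_def)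
    finally show "star_t m ?x = tri_t i w1 w2 + of_int (- of_bool (k = 3 \<or> k = 2))" .
  qed
  ultimately show ?thesis using torus_point_eq_iff n7 by force
qed

text \<open>
  By \<open>star_tri_point\<close> any vertex with positive weight may be chosen.
\<close>

definition carrier_to_torus :: "('v \<Rightarrow> real) \<Rightarrow> complex \<times> complex" where
  "carrier_to_torus x = (let m = (SOME m. x (\<rho> m) > 0) in torus_point n (star_y m x) (star_t m x))"

lemma carrier_positive_vertex:
  assumes "x \<in> geometric_carrier (cyclic_torus \<rho>)" obtains m where "x (\<rho> m) > 0"
proof -
  obtain M i w1 w2 where w: "weights i w1 w2" and x: "x = tri_point M i w1 w2"
    using carrier_tri_point[OF assms] .
  have d: "distinct [\<rho> M, \<rho> (M + i), \<rho> (M + 3)]"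
    using w by (intro tri_vertices_distinct) (simp add: weights_def)
  have "x (\<rho> M) + x (\<rho> (M + i)) + x (\<rho> (M + 3)) = 1"
    using d by (auto simp: x tri_point_def)
  then have "x (\<rho> M) > 0 \<or> x (\<rho> (M + i)) > 0 \<or> x (\<rho> (M + 3)) > 0" by linarith
  then show thesis using that by blast
qed

lemma carrier_to_torus_tri_point:
  assumes w: "weights i w1 w2"
  shows "carrier_to_torus (tri_point M i w1 w2) = torus_point n (tri_y M i w1 w2) (tri_t i w1 w2)"
proof -
  have "\<exists>m. tri_point M i w1 w2 (\<rho> m) > 0"
    using carrier_positive_vertex[OF tri_point_carrier[OF w]] by metis
  from star_tri_point[OF w someI_ex[OF this]] show ?thesis
    by (simp only: carrier_to_torus_def Let_def)
qed

lemma carrier_to_torus_star: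
  assumes "x \<in> geometric_carrier (cyclic_torus \<rho>)" "x (\<rho> m) > 0"
  shows "carrier_to_torus x = torus_point n (star_y m x) (star_t m x)"
proof -
  obtain M i w1 w2 where w: "weights i w1 w2" and x: "x = tri_point M i w1 w2"
    using carrier_tri_point[OF assms(1)] .
  show ?thesis
    unfolding x carrier_to_torus_tri_point[OF w] star_tri_point[OF w assms(2)[unfolded x]] ..
qed

text \<open>
  Open stars of vertices cover the carrier, and on each of them the map is given by the continuous
  formula of that star.
\<close>

lemma continuous_carrier_to_torus:
  "continuous_on (geometric_carrier (cyclic_torus \<rho>)) carrier_to_torus"
  unfolding continuous_on_def
proof
  let ?T = "geometric_carrier (cyclic_torus \<rho>)"
  fix x assume x: "x \<in> ?T"
  obtain m where m: "x (\<rho> m) > 0" using carrier_positive_vertex[OF x] .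
  define G where "G z = torus_point n (star_y m z) (star_t m z)" for z
  have coord: "continuous_on UNIV (\<lambda>z::'v \<Rightarrow> real. z v)" for v by simp
  have "continuous_on UNIV (star_y m)" "continuous_on UNIV (star_t m)"
    unfolding star_y_def star_t_def by (intro continuous_intros coord)+
  then have "continuous_on UNIV G"
    unfolding G_def torus_point_def using n7 by (intro continuous_intros) auto
  then have "(G \<longlongrightarrow> G x) (at x within ?T)"
    by (meson UNIV_I continuous_on_def subset_UNIV tendsto_within_subset)
  moreover have "\<forall>\<^sub>F z in at x within ?T. G z = carrier_to_torus z"
  proof -
    have "open {z::'v \<Rightarrow> real. z (\<rho> m) > 0}"
      by (intro open_Collect_less continuous_on_const coord)
    then show ?thesis
      using m carrier_to_torus_star unfolding eventually_at_topological G_def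
      by (intro exI[of _ "{z. z (\<rho> m) > 0}"]) auto
  qed
  ultimately show "(carrier_to_torus \<longlongrightarrow> carrier_to_torus x) (at x within ?T)"
    using carrier_to_torus_star[OF x m] Lim_transform_eventually unfolding G_def by force
qed

text \<open>
  The inverse of \<open>carrier_to_torus\<close>, lifted to the plane: the integer parts of the coordinates select a square of the
  grid, and the fractional parts select one of its two triangles and the weights there.
\<close>

definition grid_point :: "real \<Rightarrow> real \<Rightarrow> 'v \<Rightarrow> real" where
  "grid_point y t = (let s = y - 3 * t; M = \<lfloor>s\<rfloor> + 3 * \<lfloor>t\<rfloor> in
    if frac s + frac t \<le> 1 then tri_point M 1 (frac s) (frac t)
    else tri_point (M + 1) 2 (1 - frac s) (frac s + frac t - 1))"

lemma grid_point_eq: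
  assumes "y - 3 * t = of_int p + a" "t = of_int q + b" "0 \<le> a" "a < 1" "0 \<le> b" "b < 1"
  shows "grid_point y t = (if a + b \<le> 1 then tri_point (p + 3 * q) 1 a b
    else tri_point (p + 3 * q + 1) 2 (1 - a) (a + b - 1))"
proof -
  have "\<lfloor>y - 3 * t\<rfloor> = p" "\<lfloor>t\<rfloor> = q" using assms by (auto intro!: floor_unique)
  moreover from this have "frac (y - 3 * t) = a" "frac t = b" using assms by (simp_all add: frac_def)
  ultimately show ?thesis by (simp add: grid_point_def Let_def)
qed

lemma grid_point_periodic: "grid_point (y + of_int (n * l)) (t + of_int k) = grid_point y t"
proof -
  define s where "s = y - 3 * t"
  have "y + of_int (n * l) - 3 * (t + of_int k) = of_int (\<lfloor>s\<rfloor> + n * l - 3 * k) + frac s"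
    by (simp add: s_def frac_def algebra_simps)
  moreover have "t + of_int k = of_int (\<lfloor>t\<rfloor> + k) + frac t" by (simp add: frac_def)
  ultimately have "grid_point (y + of_int (n * l)) (t + of_int k) =
      (if frac s + frac t \<le> 1 then tri_point (\<lfloor>s\<rfloor> + n * l - 3 * k + 3 * (\<lfloor>t\<rfloor> + k)) 1 (frac s) (frac t)
       else tri_point (\<lfloor>s\<rfloor> + n * l - 3 * k + 3 * (\<lfloor>t\<rfloor> + k) + 1) 2 (1 - frac s) (frac s + frac t - 1))"
    by (rule grid_point_eq) (simp_all add: frac_lt_1)
  also have "\<dots> = grid_point y t"
  proof -
    have shift: "\<lfloor>s\<rfloor> + n * l - 3 * k + 3 * (\<lfloor>t\<rfloor> + k) = \<lfloor>s\<rfloor> + 3 * \<lfloor>t\<rfloor> + n * l"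
      "\<lfloor>s\<rfloor> + 3 * \<lfloor>t\<rfloor> + n * l + 1 = \<lfloor>s\<rfloor> + 3 * \<lfloor>t\<rfloor> + 1 + n * l" by simp_all
    show ?thesis
      unfolding shift tri_point_periodic by (simp only: grid_point_def Let_def s_def)
  qed
  finally show ?thesis .
qed

text \<open>
  Points on the edge of a triangle may be assigned to a neighbouring triangle or square by the integer
  parts; the cases below check that they get the same barycentric coordinates.
\<close>

lemma grid_point_tri:
  assumes w: "weights i w1 w2"
  shows "grid_point (tri_y M i w1 w2) (tri_t i w1 w2) = tri_point M i w1 w2"
proof -
  let ?y = "tri_y M i w1 w2" and ?t = "tri_t i w1 w2"
  have w0: "0 \<le> w1" "0 \<le> w2" "w1 + w2 \<le> 1" using w by (simp_all add: weights_def)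
  from w consider "i = 1" | "i = 2" by (auto simp: weights_def)
  then show ?thesis
  proof cases
    case 1
    have yt: "?y - 3 * ?t = of_int M + w1" "?t = w2" by (simp_all add: 1 tri_y_def tri_t_def)
    consider "w1 < 1" "w2 < 1" | "w1 = 1" "w2 = 0" | "w1 = 0" "w2 = 1" using w0 by linarith
    then show ?thesis
    proof cases
      case 1
      then show ?thesis
        using grid_point_eq[of ?y ?t M w1 0 w2] w0 yt \<open>i = 1\<close> by simp
    next
      case 2
      have "grid_point ?y ?t = tri_point (M + 1) 1 0 0"
        using grid_point_eq[of ?y ?t "M + 1" 0 0 0] yt 2 by simp
      then show ?thesis by (simp add: \<open>i = 1\<close> 2 tri_point_def fun_eq_iff)
    next
      case 3
      have "grid_point ?y ?t = tri_point (M + 3) 1 0 0"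
        using grid_point_eq[of ?y ?t M 0 1 0] yt 3 by simp
      then show ?thesis by (simp add: \<open>i = 1\<close> 3 tri_point_def fun_eq_iff)
    qed
  next
    case 2
    have yt: "?y - 3 * ?t = of_int M - w1" "?t = w1 + w2" by (simp_all add: 2 tri_y_def tri_t_def)
    consider "w1 = 0" "w2 < 1" | "w1 = 0" "w2 = 1" | "w1 > 0" "w1 + w2 < 1" | "w1 > 0" "w1 + w2 = 1"
      using w0 by linarith
    then show ?thesis
    proof cases
      case 1
      have "grid_point ?y ?t = tri_point M 1 0 w2"
        using grid_point_eq[of ?y ?t M 0 0 w2] yt 1 w0 by simp
      then show ?thesis by (simp add: \<open>i = 2\<close> 1 tri_point_def fun_eq_iff)
    next
      case 2
      have "grid_point ?y ?t = tri_point (M + 3) 1 0 0"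
        using grid_point_eq[of ?y ?t M 0 1 0] yt 2 by simp
      then show ?thesis by (simp add: \<open>i = 2\<close> 2 tri_point_def fun_eq_iff)
    next
      case 3
      have "grid_point ?y ?t = (if w2 \<le> 0 then tri_point (M - 1) 1 (1 - w1) (w1 + w2) else tri_point M 2 w1 w2)"
        using grid_point_eq[of ?y ?t "M - 1" "1 - w1" 0 "w1 + w2"] yt 3 w0 by simp
      moreover have "tri_point (M - 1) 1 (1 - w1) w1 = tri_point M 2 w1 0"
        by (simp add: tri_point_def fun_eq_iff add.commute)
      ultimately show ?thesis using w0 by (cases "w2 = 0") (simp_all add: \<open>i = 2\<close>)
    next
      case 4
      then have w2: "w2 = 1 - w1" by simp
      have "grid_point ?y ?t = tri_point (M + 2) 1 (1 - w1) 0"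
        using grid_point_eq[of ?y ?t "M - 1" "1 - w1" 1 0] yt 4 w0 by (simp add: algebra_simps)
      moreover have "tri_point (M + 2) 1 (1 - w1) 0 = tri_point M 2 w1 (1 - w1)"
        by (simp add: tri_point_def fun_eq_iff add.commute)
      ultimately show ?thesis by (simp add: \<open>i = 2\<close> w2)
    qed
  qed
qed

lemma grid_point_is_tri_point:
  obtains M i w1 w2 k where "weights i w1 w2" "tri_y M i w1 w2 = y" "tri_t i w1 w2 = t + of_int k"
proof -
  define s where "s = y - 3 * t"
  define a where "a = frac s"
  define b where "b = frac t"
  have ab: "0 \<le> a" "a < 1" "0 \<le> b" "b < 1" by (simp_all add: a_def b_def frac_lt_1)
  have s: "s = of_int \<lfloor>s\<rfloor> + a" and t: "t = of_int \<lfloor>t\<rfloor> + b" by (simp_all add: a_def b_def frac_def)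
  have y: "y = of_int (\<lfloor>s\<rfloor> + 3 * \<lfloor>t\<rfloor>) + a + 3 * b" using s t by (simp add: s_def)
  show thesis
  proof (cases "a + b \<le> 1")
    case True
    show thesis
      using that[of 1 a b "\<lfloor>s\<rfloor> + 3 * \<lfloor>t\<rfloor>" "- \<lfloor>t\<rfloor>"] True ab y t
      by (simp add: weights_def tri_y_def tri_t_def)
  next
    case False
    show thesis
      using that[of 2 "1 - a" "a + b - 1" "\<lfloor>s\<rfloor> + 3 * \<lfloor>t\<rfloor> + 1" "- \<lfloor>t\<rfloor>"] False ab y t
      by (simp add: weights_def tri_y_def tri_t_def)
  qed
qed

text \<open>
  The carrier is compact, so a continuous bijection suffices. Injectivity comes from the lifted inverse
  \<open>grid_point\<close> being periodic under the lattice.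
\<close>

lemma carrier_torus_homeomorphic:
  "top_of_set (geometric_carrier (cyclic_torus \<rho>)) homeomorphic_space standard_torus"
proof -
  let ?T = "geometric_carrier (cyclic_torus \<rho>)"
  have n0: "n > 0" using n7 by simp
  have "inj_on carrier_to_torus ?T"
  proof (rule inj_onI)
    fix x x' assume x: "x \<in> ?T" and x': "x' \<in> ?T" and eq: "carrier_to_torus x = carrier_to_torus x'"
    obtain M i w1 w2 where w: "weights i w1 w2" and x: "x = tri_point M i w1 w2"
      using carrier_tri_point[OF x] .
    obtain M' i' w1' w2' where w': "weights i' w1' w2'" and x': "x' = tri_point M' i' w1' w2'"
      using carrier_tri_point[OF x'] .
    have "torus_point n (tri_y M i w1 w2) (tri_t i w1 w2) = torus_point n (tri_y M' i' w1' w2') (tri_t i' w1' w2')"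
      using eq carrier_to_torus_tri_point w w' x x' by simp
    then obtain l k where "tri_y M i w1 w2 = tri_y M' i' w1' w2' + of_int (n * l)"
        "tri_t i w1 w2 = tri_t i' w1' w2' + of_int k"
      using torus_point_eq_iff[OF n0] by blast
    then show "x = x'"
      using grid_point_tri[OF w, of M] grid_point_tri[OF w', of M'] grid_point_periodic x x' by metis
  qed
  moreover have "carrier_to_torus ` ?T = sphere 0 1 \<times> sphere 0 1"
  proof
    show "carrier_to_torus ` ?T \<subseteq> sphere 0 1 \<times> sphere 0 1"
      by (auto simp: carrier_to_torus_def Let_def torus_point_def)
    show "sphere 0 1 \<times> sphere 0 1 \<subseteq> carrier_to_torus ` ?T"
    proof
      fix z :: "complex \<times> complex" assume "z \<in> sphere 0 1 \<times> sphere 0 1"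
      then obtain y t where z: "torus_point n y t = z" using torus_point_surj[OF n0] by blast
      obtain M i w1 w2 k where w: "weights i w1 w2" and "tri_y M i w1 w2 = y" "tri_t i w1 w2 = t + of_int k"
        by (rule grid_point_is_tri_point)
      then have "torus_point n (tri_y M i w1 w2) (tri_t i w1 w2) = z"
        unfolding z[symmetric] torus_point_eq_iff[OF n0] by (intro exI[of _ 0] exI[of _ k]) simp
      then have "z = carrier_to_torus (tri_point M i w1 w2)" using carrier_to_torus_tri_point[OF w] by simp
      then show "z \<in> carrier_to_torus ` ?T" using tri_point_carrier[OF w] by blast
    qed
  qed
  ultimately have "?T homeomorphic sphere (0::complex) 1 \<times> sphere (0::complex) 1"
    using continuous_carrier_to_torus compact_carrier[OF finite_simplicial_complex_torus]
    by (intro homeomorphic_compact)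
  then show ?thesis
    unfolding standard_torus_def homeomorphic_def homeomorphic_space_def
    using homeomorphism_imp_homeomorphic_maps by blast
qed

end

section \<open>Attaching a 7-vertex torus\<close>

text \<open>
  One step of the construction, with an arbitrary map \<open>f'\<close> on the attached torus. The triangle \<open>[u, v, w]\<close> has
  coefficient \<open>-1\<close> in \<open>c\<close>, which cancels the coefficient of \<open>[\<rho> 1, \<rho> 2, \<rho> 4]\<close>. The last
  conclusion keeps track of the other triangles that are available for later steps.
\<close>

lemma attach_torus:
  assumes K: "surface_complex K c" and surf: "closed_orientable_surface g (top_of_set (geometric_carrier K))"
    and g: "g \<ge> 1"
    and f: "simplicial_map K torus7 f" "chain_map 2 K f c = (\<lambda>s. d * torus_cycle label7 s)"
    and neg: "c [u, v, w] = -1"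
    and lab: "cyclic_labelling 7 \<rho>" "\<rho> 1 = u" "\<rho> 2 = v" "\<rho> 4 = w" "vertices K \<inter> range \<rho> = {u, v, w}"
    and f': "simplicial_map (cyclic_torus \<rho>) torus7 f'"
      "chain_map 2 (cyclic_torus \<rho>) f' (torus_cycle \<rho>) = (\<lambda>s. d' * torus_cycle label7 s)"
    and agree: "f' u = f u" "f' v = f v" "f' w = f w"
  obtains K' c' h where "surface_complex K' c'"
    and "closed_orientable_surface (Suc g) (top_of_set (geometric_carrier K'))"
    and "card (vertices K') = card (vertices K) + 4"
    and "simplicial_map K' torus7 h" and "chain_map 2 K' h c' = (\<lambda>s. (d + d') * torus_cycle label7 s)"
    and "\<And>t. c t = -1 \<Longrightarrow> set t \<noteq> {u, v, w} \<Longrightarrow> c' t = -1 \<and> map h t = map f t"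
proof -
  interpret L: cyclic_labelling 7 \<rho> by fact
  have c: "c \<in> two_cycles K" using K by (simp add: surface_complex_def fundamental_cycle_def)
  have uvw: "distinct [u, v, w]" "{u, v, w} \<in> K" using two_cycles_support[OF c, of "[u, v, w]"] neg by simp_all
  have pos: "positive \<rho> u v w" using L.positive_link[of 1 1] lab by simp
  interpret G: triangle_gluing K "cyclic_torus \<rho>" c "torus_cycle \<rho>" u v w "{u, v, w}"
  proof
    show "torus_cycle \<rho> [u, v, w] = - c [u, v, w]"
      using pos L.positive_exclusive[OF pos] neg by (simp add: torus_cycle_triple)
  qed (use K uvw lab L.surface_complex_torus L.positive_simplex[OF pos] in \<open>simp_all add: L.vertices_torus\<close>)
  have \<rho>3: "\<rho> 3 \<notin> vertices K"
  proof
    assume "\<rho> 3 \<in> vertices K"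
    then have "\<rho> 3 \<in> {u, v, w}" using lab(5) by blast
    then show False
      using L.label_near[of 0 3 1] L.label_near[of 0 3 2] L.label_near[of 0 3 4] lab(2-4) by auto
  qed
  \<comment> \<open>A second triangle of the attached torus shows that the sum of the cycles does not vanish.\<close>
  have "c [\<rho> 1, \<rho> 4, \<rho> 3] = 0"
    using two_cycles_support(3)[OF c, of "[\<rho> 1, \<rho> 4, \<rho> 3]"] \<rho>3 by fastforce
  moreover have "torus_cycle \<rho> [\<rho> 1, \<rho> 4, \<rho> 3] = 1"
    using L.positive_link[of 3 1] L.positive_exclusive[of "\<rho> 1" "\<rho> 4" "\<rho> 3"] by (simp add: torus_cycle_triple)
  ultimately have "c [\<rho> 1, \<rho> 4, \<rho> 3] + torus_cycle \<rho> [\<rho> 1, \<rho> 4, \<rho> 3] \<noteq> 0" by simp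
  then have surface: "surface_complex G.glued (\<lambda>s. c s + torus_cycle \<rho> s)"
    by (intro G.surface_complex_glued exI)
  define h where "h z = (if z \<in> vertices K then f z else f' z)" for z
  have hK: "h z = f z" if "z \<in> vertices K" for z using that by (simp only: h_def if_True)
  have hL: "h z = f' z" if z: "z \<in> vertices (cyclic_torus \<rho>)" for z
  proof (cases "z \<in> vertices K")
    case True
    then have "z \<in> {u, v, w}" using z lab(5) unfolding L.vertices_torus by blast
    then show ?thesis using agree hK[OF True] by auto
  qed (simp only: h_def if_False)
  show thesis
  proof (rule that[OF surface])
    show "closed_orientable_surface (Suc g) (top_of_set (geometric_carrier G.glued))"
      using g surf G.connected_sum_glued[OF L.carrier_torus_homeomorphic] by (rule sum_torus)
    show "card (vertices G.glued) = card (vertices K) + 4"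
      using G.card_vertices_glued by (simp add: L.vertices_torus L.card_range_label)
    show "simplicial_map G.glued torus7 h"
      using f(1) f'(1) hK hL by (rule G.simplicial_map_glued)
    show "chain_map 2 G.glued h (\<lambda>s. c s + torus_cycle \<rho> s) = (\<lambda>s. (d + d') * torus_cycle label7 s)"
      using G.chain_map_glued[of h f f', OF hK hL] by (simp add: f(2) f'(2) distrib_right)
    fix t assume t: "c t = -1" "set t \<noteq> {u, v, w}"
    then have t3: "length t = 3" "distinct t" "set t \<in> K" using two_cycles_support[OF c, of t] by simp_all
    have "set t \<notin> cyclic_torus \<rho>"
      using G.common_triangle[of "set t"] t3 t(2) by (auto simp: distinct_card)
    then have "torus_cycle \<rho> t = 0" using L.torus_cycle_support[of t] by blast
    moreover have "map h t = map f t"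
    proof (rule map_cong[OF refl])
      fix z assume "z \<in> set t"
      then have "z \<in> vertices K" using t3(3) by blast
      then show "h z = f z" by (rule hK)
    qed
    ultimately show "c t + torus_cycle \<rho> t = -1 \<and> map h t = map f t" using t(1) by simp
  qed
qed

lemma fresh_labelling:
  fixes V :: "nat set"
  assumes "finite V" "{u, v, w} \<subseteq> V" "distinct [u, v, w]"
  obtains \<rho> where "cyclic_labelling 7 \<rho>" "\<rho> 1 = u" "\<rho> 2 = v" "\<rho> 4 = w" "V \<inter> range \<rho> = {u, v, w}"
proof -
  define N where "N = Suc (Max V)"
  have N: "a < N" if "a \<in> V" for a using assms(1) that by (simp add: N_def le_imp_less_Suc)
  define \<eta> where "\<eta> r = (if r = 1 then u else if r = 2 then v else if r = 4 then w else N + nat r)" for r :: int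
  have bounds: "u < N" "v < N" "w < N" using N assms(2) by auto
  have \<eta>: "r = r'" if "\<eta> r = \<eta> r'" "0 \<le> r" "0 \<le> r'" for r r'
    using that bounds assms(3) by (auto simp: \<eta>_def eq_nat_nat_iff split: if_splits)
  define \<rho> where "\<rho> x = \<eta> (x mod 7)" for x :: int
  show thesis
  proof (rule that[of \<rho>])
    show "cyclic_labelling 7 \<rho>"
    proof
      show "\<rho> x = \<rho> y \<longleftrightarrow> 7 dvd x - y" for x y
        using \<eta>[of "x mod 7" "y mod 7"] by (auto simp: \<rho>_def simp flip: mod_eq_dvd_iff)
    qed simp
    show 124: "\<rho> 1 = u" "\<rho> 2 = v" "\<rho> 4 = w" by (simp_all add: \<rho>_def \<eta>_def)
    have "\<rho> x \<in> {u, v, w}" if "\<rho> x \<in> V" for x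
      using N[OF that] by (auto simp: \<rho>_def \<eta>_def)
    then show "V \<inter> range \<rho> = {u, v, w}"
      using 124[symmetric] assms(2) by auto
  qed
qed

text \<open>
  The state of the construction: a map of degree \<open>d\<close> from a surface of genus \<open>g\<close> with \<open>V\<close> vertices.
\<close>

definition torus7_map ::
    "nat set set \<Rightarrow> (nat list \<Rightarrow> int) \<Rightarrow> (nat \<Rightarrow> nat) \<Rightarrow> nat \<Rightarrow> nat \<Rightarrow> int \<Rightarrow> bool" where
  "torus7_map K c f g V d \<longleftrightarrow>
    surface_complex K c \<and> closed_orientable_surface g (top_of_set (geometric_carrier K)) \<and>
    card (vertices K) = V \<and> simplicial_map K torus7 f \<and>
    chain_map 2 K f c = (\<lambda>s. d * torus_cycle label7 s)"

text \<open>
  The triangles along which a copy of the target can be attached: they lie over \<open>[1, 2, 4]\<close>, with the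
  opposite orientation. Listing the vertices in the order of their images counts each triangle once.
\<close>

definition reversed_triangles :: "(nat list \<Rightarrow> int) \<Rightarrow> (nat \<Rightarrow> nat) \<Rightarrow> nat list set" where
  "reversed_triangles c f = {s. map f s = [1, 2, 4] \<and> c s = -1}"

lemma finite_reversed_triangles:
  assumes "torus7_map K c f g V d" shows "finite (reversed_triangles c f)"
proof (rule finite_subset)
  have c: "c \<in> chains 2 K" and "finite (vertices K)"
    using assms finite_vertices[of K]
    by (auto simp: torus7_map_def surface_complex_def fundamental_cycle_def two_cycles_def)
  show "finite (ordered_simplices 2 K)" by (rule finite_ordered_simplices) fact
  show "reversed_triangles c f \<subseteq> ordered_simplices 2 K"
  proof
    fix s assume "s \<in> reversed_triangles c f"
    then have "c s \<noteq> 0" by (simp add: reversed_triangles_def)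
    then show "s \<in> ordered_simplices 2 K" using c unfolding chains_def by blast
  qed
qed

text \<open>
  The attached torus is a copy of the target with vertices \<open>u\<close>, \<open>v\<close>, \<open>w\<close> in the places of 1, 2, 4, mapped
  isomorphically. Only the triangle used for the gluing is lost.
\<close>

lemma attach_torus_degree_one:
  assumes st: "torus7_map K c f g V d" and g: "g \<ge> 1" and m: "Suc m \<le> card (reversed_triangles c f)"
  obtains K' c' f' where "torus7_map K' c' f' (Suc g) (V + 4) (d + 1)" "m \<le> card (reversed_triangles c' f')"
proof -
  have st': "surface_complex K c" "closed_orientable_surface g (top_of_set (geometric_carrier K))"
      "card (vertices K) = V" "simplicial_map K torus7 f" "chain_map 2 K f c = (\<lambda>s. d * torus_cycle label7 s)"
    using st by (simp_all add: torus7_map_def)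
  have c: "c \<in> two_cycles K" and finV: "finite (vertices K)"
    using st'(1) by (simp_all add: surface_complex_def fundamental_cycle_def finite_vertices)
  have "reversed_triangles c f \<noteq> {}" using m by auto
  then obtain s where "s \<in> reversed_triangles c f" by blast
  then have s: "map f s = [1, 2, 4]" "c s = -1" by (simp_all only: reversed_triangles_def mem_Collect_eq)
  then obtain u v w where uvw: "s = [u, v, w]" "f u = 1" "f v = 2" "f w = 4" by auto
  have tri: "distinct [u, v, w]" "{u, v, w} \<in> K"
    using two_cycles_support[OF c, of s] s(2) uvw(1) by simp_all
  then have "{u, v, w} \<subseteq> vertices K" by blast
  then obtain \<rho> where \<rho>: "cyclic_labelling 7 \<rho>" "\<rho> 1 = u" "\<rho> 2 = v" "\<rho> 4 = w" "vertices K \<inter> range \<rho> = {u, v, w}"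
    using fresh_labelling[OF finV _ tri(1)] by metis
  interpret L: cyclic_labelling 7 \<rho> by fact
  define f' where "f' z = label7 (SOME x. \<rho> x = z)" for z
  have f': "f' (\<rho> x) = label7 x" for x
  proof -
    have "\<rho> (SOME y. \<rho> y = \<rho> x) = \<rho> x" by (rule someI) (rule refl)
    then show ?thesis by (simp add: f'_def L.label_eq T7.label_eq)
  qed
  note rel = relabel_torus[OF \<rho>(1) cyclic_labelling_7, of f', OF f']
  have "chain_map 2 (cyclic_torus \<rho>) f' (torus_cycle \<rho>) = (\<lambda>s. 1 * torus_cycle label7 s)"
    using rel(2) by simp
  moreover have "f' u = f u" "f' v = f v" "f' w = f w"
    using f'[of 1] f'[of 2] f'[of 4] \<rho>(2-4) uvw(2-4) label7_124 by simp_all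
  ultimately obtain K' c' h where new: "surface_complex K' c'"
      "closed_orientable_surface (Suc g) (top_of_set (geometric_carrier K'))"
      "card (vertices K') = card (vertices K) + 4" "simplicial_map K' torus7 h"
      "chain_map 2 K' h c' = (\<lambda>s. (d + 1) * torus_cycle label7 s)"
    and old: "\<And>t. c t = -1 \<Longrightarrow> set t \<noteq> {u, v, w} \<Longrightarrow> c' t = -1 \<and> map h t = map f t"
    using attach_torus[OF st'(1,2) g st'(4,5) s(2)[unfolded uvw(1)] \<rho> rel(1)[folded torus7_eq]] by blast
  have st2: "torus7_map K' c' h (Suc g) (V + 4) (d + 1)" using new st'(3) by (simp add: torus7_map_def)
  have "reversed_triangles c f - {s} \<subseteq> reversed_triangles c' h"
  proof
    fix t assume t: "t \<in> reversed_triangles c f - {s}"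
    have "t \<in> reversed_triangles c f" and "t \<noteq> s" using t by simp_all
    then have ft: "map f t = [1, 2, 4]" and ct: "c t = -1"
      by (simp_all only: reversed_triangles_def mem_Collect_eq)
    have "set t \<noteq> {u, v, w}"
    proof
      assume "set t = {u, v, w}"
      moreover have "inj_on f {u, v, w}" using uvw(2-4) by (auto simp: inj_on_def)
      ultimately have "map f t = map f s \<longleftrightarrow> t = s"
        using inj_on_map_eq_map[of f t s] uvw(1) by simp
      then show False using ft s(1) \<open>t \<noteq> s\<close> by argo
    qed
    from old[OF ct this] have "c' t = -1" and "map h t = map f t" by (fact conjunct1, fact conjunct2)
    with ft have "c' t = -1" "map h t = [1, 2, 4]" by (simp_all only:)
    then show "t \<in> reversed_triangles c' h" by (simp only: reversed_triangles_def mem_Collect_eq)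
  qed
  then have "card (reversed_triangles c f - {s}) \<le> card (reversed_triangles c' h)"
    using finite_reversed_triangles[OF st2] by (intro card_mono)
  moreover have "card (reversed_triangles c f - {s}) = card (reversed_triangles c f) - 1"
    using s by (intro card_Diff_singleton) (simp add: reversed_triangles_def)
  ultimately show thesis using that[OF st2] m by simp
qed

lemma torus7_subset:
  "\<sigma> \<in> torus7 \<Longrightarrow> \<tau> \<subseteq> \<sigma> \<Longrightarrow> \<tau> \<noteq> {} \<Longrightarrow> \<tau> \<in> torus7"
  unfolding torus7_def by blast

lemma simplicial_map_into_simplex:
  assumes "\<sigma> \<in> torus7" "f ` vertices K \<subseteq> \<sigma>" "{} \<notin> K"
  shows "simplicial_map K torus7 f"
  unfolding simplicial_map_def
proof
  fix \<tau> assume "\<tau> \<in> K"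
  then have "f ` \<tau> \<subseteq> \<sigma>" "f ` \<tau> \<noteq> {}" using assms(2,3) by blast+
  then show "f ` \<tau> \<in> torus7" using assms(1) torus7_subset by blast
qed

text \<open>
  Any triangle of \<open>K\<close> will do here: the attached torus is mapped into the image of that triangle, so that it
  contributes degree 0.
\<close>

lemma attach_torus_degree_zero:
  assumes st: "torus7_map K c f g V d" and g: "g \<ge> 1"
  obtains K' c' f' where "torus7_map K' c' f' (Suc g) (V + 4) d"
proof -
  have st': "surface_complex K c" "closed_orientable_surface g (top_of_set (geometric_carrier K))"
      "card (vertices K) = V" "simplicial_map K torus7 f" "chain_map 2 K f c = (\<lambda>s. d * torus_cycle label7 s)"
    using st by (simp_all add: torus7_map_def)
  have fc: "fundamental_cycle K c" and c: "c \<in> two_cycles K" and finV: "finite (vertices K)"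
    using st'(1) by (simp_all add: surface_complex_def fundamental_cycle_def finite_vertices)
  obtain s where nz: "c s \<noteq> 0" using fc by (auto simp: fundamental_cycle_def)
  note s3 = two_cycles_support[OF c nz]
  obtain p q r where s: "s = [p, q, r]" using s3(1) by (auto simp: numeral_3_eq_3 length_Suc_conv)
  have "\<bar>c s\<bar> = 1" using fc s3 by (simp add: fundamental_cycle_def ordered_simplices_def)
  then have "c [p, q, r] = -1 \<or> c [q, p, r] = -1"
    using two_cycles_alternating(1)[OF c, of p q r] by (auto simp: s)
  then obtain u v w where neg: "c [u, v, w] = -1" by blast
  have tri: "distinct [u, v, w]" "{u, v, w} \<in> K"
    using two_cycles_support[OF c, of "[u, v, w]"] neg by simp_all
  then have "{u, v, w} \<subseteq> vertices K" by blast
  then obtain \<rho> where \<rho>: "cyclic_labelling 7 \<rho>" "\<rho> 1 = u" "\<rho> 2 = v" "\<rho> 4 = w" "vertices K \<inter> range \<rho> = {u, v, w}"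
    using fresh_labelling[OF finV _ tri(1)] by metis
  interpret L: cyclic_labelling 7 \<rho> by fact
  \<comment> \<open>The vertex \<open>f u\<close> is an arbitrary choice among the images of the triangle.\<close>
  define f' where "f' z = (if z \<in> {u, v, w} then f z else f u)" for z
  have img: "f' ` A \<subseteq> f ` {u, v, w}" for A by (auto simp: f'_def)
  have "f ` {u, v, w} \<in> torus7" using st'(4) tri(2) unfolding simplicial_map_def by (rule bspec)
  then have sm: "simplicial_map (cyclic_torus \<rho>) torus7 f'"
    by (rule simplicial_map_into_simplex[OF _ img]) (simp add: cyclic_torus_def)
  have "chain_map 2 (cyclic_torus \<rho>) f' (torus_cycle \<rho>) = (\<lambda>s. 0)"
  proof (rule chain_map_degenerate[OF L.torus_cycle_in_two_cycles _ _ _ img])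
    show "finite (vertices (cyclic_torus \<rho>))" by (simp add: L.vertices_torus L.finite_range_label)
    have "card (f ` {u, v, w}) \<le> card {u, v, w}" by (rule card_image_le) simp
    then show "card (f ` {u, v, w}) \<le> 3" using tri(1) by simp
  qed simp
  then have push: "chain_map 2 (cyclic_torus \<rho>) f' (torus_cycle \<rho>) = (\<lambda>s. 0 * torus_cycle label7 s)" by simp
  have agree: "f' u = f u" "f' v = f v" "f' w = f w" by (simp_all add: f'_def)
  show thesis
  proof (rule attach_torus[OF st'(1,2) g st'(4,5) neg \<rho> sm push agree])
    fix K' :: "nat set set" and c' h
    assume "surface_complex K' c'"
      and "closed_orientable_surface (Suc g) (top_of_set (geometric_carrier K'))"
      and "card (vertices K') = card (vertices K) + 4" and "simplicial_map K' torus7 h"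
      and "chain_map 2 K' h c' = (\<lambda>s. (d + 0) * torus_cycle label7 s)"
    then have "torus7_map K' c' h (Suc g) (V + 4) d" using st'(3) by (simp add: torus7_map_def)
    then show thesis by (rule that)
  qed
qed

section \<open>A folded torus with many reversed triangles\<close>

text \<open>
  The vertices \<open>0, 1, 2, \<dots>\<close> are coloured in pairs by 1, 1, 2, 2, 4, 4, 1, 1, and so on. Then the triangle with indices
  \<open>2 j + 1\<close>, \<open>2 j + 3\<close>, \<open>2 j + 4\<close> has three consecutive colours in cyclic order, while \<open>2 j + 1\<close>, \<open>2 j + 4\<close>, \<open>2 j + 3\<close>
  is its positive orientation. With \<open>2 k + 5\<close> vertices these triangles for \<open>j < k\<close> do not wrap
  around, and \<open>2 k + 5 \<ge> 7\<close> holds as soon as \<open>k \<ge> 1\<close>.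
\<close>

lemma folded_torus:
  assumes k: "k \<ge> 1"
  obtains K c f where "torus7_map K c f 1 (2 * k + 5) 0" "k \<le> card (reversed_triangles c f)"
proof -
  define n where "n = 2 * int k + 5"
  define \<rho> where "\<rho> x = nat (x mod n)" for x
  define f where "f z = (if z div 2 mod 3 = 0 then 1 else if z div 2 mod 3 = 1 then 2 else 4 :: nat)" for z :: nat
  interpret T: cyclic_labelling n \<rho>
  proof
    show "n \<ge> 7" using k by (simp add: n_def)
    then show "\<rho> x = \<rho> y \<longleftrightarrow> n dvd x - y" for x y
      by (simp add: \<rho>_def eq_nat_nat_iff mod_eq_dvd_iff)
  qed
  have img: "f ` A \<subseteq> {1, 2, 4}" for A by (auto simp: f_def)
  have "{1, 2, 4} \<in> torus7" by (auto simp: torus7_def torus7_triangles_def)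
  then have "simplicial_map (cyclic_torus \<rho>) torus7 f"
    by (rule simplicial_map_into_simplex[OF _ img]) (simp add: cyclic_torus_def)
  moreover have "chain_map 2 (cyclic_torus \<rho>) f (torus_cycle \<rho>) = (\<lambda>s. 0)"
    using T.torus_cycle_in_two_cycles T.finite_range_label
    by (intro chain_map_degenerate[OF _ _ _ _ img]) (simp_all add: T.vertices_torus)
  moreover have "closed_orientable_surface 1 (top_of_set (geometric_carrier (cyclic_torus \<rho>)))"
    by (rule torus[OF T.carrier_torus_homeomorphic])
  moreover have "card (vertices (cyclic_torus \<rho>)) = 2 * k + 5"
    by (simp add: T.vertices_torus T.card_range_label n_def)
  ultimately have st: "torus7_map (cyclic_torus \<rho>) (torus_cycle \<rho>) f 1 (2 * k + 5) 0"
    using T.surface_complex_torus by (simp add: torus7_map_def)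
  \<comment> \<open>The triangle number \<open>j\<close>, listed starting from its vertex of colour 1.\<close>
  define tri where "tri j = (let p = 2 * j + 1; q = 2 * j + 3; r = 2 * j + 4 in
    if j mod 3 = 0 then [p, q, r] else if j mod 3 = 1 then [r, p, q] else [q, r, p])" for j :: nat
  have "tri j \<in> reversed_triangles (torus_cycle \<rho>) f" if j: "j < k" for j
  proof -
    define p q r where "p = 2 * j + 1" and "q = 2 * j + 3" and "r = 2 * j + 4"
    have tri: "tri j = (if j mod 3 = 0 then [p, q, r] else if j mod 3 = 1 then [r, p, q] else [q, r, p])"
      by (simp only: tri_def Let_def p_def q_def r_def)
    have "\<rho> (int p) = p" "\<rho> (int p + 2) = q" "\<rho> (int p + 3) = r"
      using j by (simp_all add: \<rho>_def n_def nat_add_distrib p_def q_def r_def)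
    then have pos: "positive \<rho> p r q" using T.positive_link[of 3 "int p"] by simp
    then have neg: "torus_cycle \<rho> [p, q, r] = -1"
      using T.positive_exclusive[OF pos] by (simp add: torus_cycle_triple)
    have cyc: "torus_cycle \<rho> [r, p, q] = -1" "torus_cycle \<rho> [q, r, p] = -1"
      using neg two_cycles_alternating(3,4)[OF T.torus_cycle_in_two_cycles, of p q r] by simp_all
    have div2: "p div 2 = j" "q div 2 = j + 1" "r div 2 = j + 2"
      by (simp_all add: p_def q_def r_def)
    have "(j mod 3 = 0 \<and> (j + 1) mod 3 = 1 \<and> (j + 2) mod 3 = 2)
        \<or> (j mod 3 = 1 \<and> (j + 1) mod 3 = 2 \<and> (j + 2) mod 3 = 0)
        \<or> (j mod 3 = 2 \<and> (j + 1) mod 3 = 0 \<and> (j + 2) mod 3 = 1)" by presburger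
    then consider "j mod 3 = 0" "f p = 1" "f q = 2" "f r = 4"
      | "j mod 3 = 1" "f p = 2" "f q = 4" "f r = 1"
      | "j mod 3 = 2" "f p = 4" "f q = 1" "f r = 2"
      unfolding f_def div2 by fastforce
    then show ?thesis
      by cases (simp_all add: reversed_triangles_def tri neg cyc)
  qed
  then have "tri ` {..<k} \<subseteq> reversed_triangles (torus_cycle \<rho>) f" by blast
  moreover have "inj_on tri {..<k}"
  proof (rule inj_onI)
    \<comment> \<open>Rotating the list preserves the sum of its entries, which determines \<open>j\<close>.\<close>
    have "sum_list (tri j) = 6 * j + 8" for j by (simp add: tri_def Let_def)
    then show "i = j" if "tri i = tri j" for i j using that by (metis add_right_cancel mult_cancel1 zero_neq_numeral)
  qed
  ultimately have "k \<le> card (reversed_triangles (torus_cycle \<rho>) f)"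
    using card_mono[OF finite_reversed_triangles[OF st], of "tri ` {..<k}"] by (simp add: card_image)
  with st show thesis by (rule that)
qed

section \<open>Realising the degree\<close>

lemma torus7_map_positive_degree:
  assumes "j \<le> k" "k \<ge> 1"
  shows "\<exists>K c f. torus7_map K c f (j + 1) (2 * k + 5 + 4 * j) (int j) \<and> k - j \<le> card (reversed_triangles c f)"
  using assms(1)
proof (induction j)
  case 0
  obtain K c f where "torus7_map K c f 1 (2 * k + 5) 0" "k \<le> card (reversed_triangles c f)"
    using folded_torus[OF assms(2)] .
  then show ?case by auto
next
  case (Suc j)
  then obtain K c f where st: "torus7_map K c f (j + 1) (2 * k + 5 + 4 * j) (int j)"
      "k - j \<le> card (reversed_triangles c f)" by auto
  have "Suc (k - Suc j) \<le> card (reversed_triangles c f)" using st(2) Suc.prems by simp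
  then obtain K' c' f' where "torus7_map K' c' f' (Suc (j + 1)) (2 * k + 5 + 4 * j + 4) (int j + 1)"
      "k - Suc j \<le> card (reversed_triangles c' f')"
    using attach_torus_degree_one[OF st(1) le_add2] by blast
  then show ?case by (intro exI[of _ K'] exI[of _ c'] exI[of _ f']) (simp add: algebra_simps)
qed

lemma torus7_map_add_handles:
  assumes "k \<ge> 1"
  shows "\<exists>K c f. torus7_map K c f (k + 1 + h) (6 * k + 5 + 4 * h) (int k)"
proof (induction h)
  case 0
  then show ?case using torus7_map_positive_degree[of k k] assms by (auto simp: algebra_simps)
next
  case (Suc h)
  then obtain K c f where "torus7_map K c f (k + 1 + h) (6 * k + 5 + 4 * h) (int k)" by blast
  then obtain K' c' f' where "torus7_map K' c' f' (Suc (k + 1 + h)) (6 * k + 5 + 4 * h + 4) (int k)"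
    using attach_torus_degree_zero by (metis le_add2 trans_le_add1)
  then show ?case by (intro exI[of _ K'] exI[of _ c'] exI[of _ f']) (simp add: algebra_simps)
qed

text \<open>
  Reversing the orientation of the domain changes the sign of the degree.
\<close>

lemma has_degree_scaled:
  assumes st: "torus7_map K c f g V d" and \<epsilon>: "\<bar>\<epsilon>\<bar> = 1"
  shows "has_degree K {\<lambda>s. \<epsilon> * c s} torus7 torus7_class f (\<epsilon> * d)"
    and "fundamental_class K {\<lambda>s. \<epsilon> * c s}"
proof -
  have K: "\<forall>\<sigma>\<in>K. card \<sigma> \<le> 3" "c \<in> two_cycles K" "\<And>z. z \<in> two_cycles K \<Longrightarrow> \<exists>m::int. z = (\<lambda>s. m * c s)"
      "\<exists>s. c s \<noteq> 0"
    and f: "simplicial_map K torus7 f" "chain_map 2 K f c = (\<lambda>s. d * torus_cycle label7 s)"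
    using st by (auto simp: torus7_map_def surface_complex_def fundamental_cycle_def)
  have \<epsilon>2: "\<epsilon> * \<epsilon> = 1" using \<epsilon> by (metis abs_mult_self_eq mult_1)
  show fc: "fundamental_class K {\<lambda>s. \<epsilon> * c s}"
  proof (rule fundamental_class_if_generator[OF K(1) two_cycles_scale[OF K(2)]])
    show "\<exists>s. \<epsilon> * c s \<noteq> 0" using K(4) \<epsilon> by auto
    fix z assume "z \<in> two_cycles K"
    then obtain m :: int where m: "z = (\<lambda>s. m * c s)" using K(3) by blast
    have "(m * \<epsilon>) * (\<epsilon> * c s) = (\<epsilon> * \<epsilon>) * (m * c s)" for s by (simp only: ac_simps)
    then have "z = (\<lambda>s. (m * \<epsilon>) * (\<epsilon> * c s))" by (simp only: m \<epsilon>2 mult_1)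
    then show "\<exists>m::int. z = (\<lambda>s. m * (\<epsilon> * c s))" by blast
  qed
  have "chain_map 2 K f (\<lambda>s. \<epsilon> * c s) = (\<lambda>s. \<epsilon> * chain_map 2 K f c s)"
    by (auto simp: chain_map_def sum_distrib_left)
  then have "chain_map 2 K f (\<lambda>s. \<epsilon> * c s) = (\<lambda>s. \<epsilon> * d * torus_cycle label7 s)"
    by (simp add: f(2) mult.assoc)
  then show "has_degree K {\<lambda>s. \<epsilon> * c s} torus7 torus7_class f (\<epsilon> * d)"
    using K(1) T7.dim_torus fc f(1) T7.torus_cycle_in_two_cycles
      fundamental_class_surface_complex[OF T7.surface_complex_torus]
    unfolding torus7_class_eq torus7_eq by (intro has_degree_singleton)
qed

theorem theorem11:
  fixes g i :: nat and d :: int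
  assumes "g \<ge> 2" and "1 \<le> i" and "i \<le> g - 1" and "\<bar>d\<bar> = int g - int i"
  shows "\<exists>(M :: (nat \<Rightarrow> real) topology) (K :: nat set set) \<alpha> f.
    closed_orientable_surface g M \<and> triangulates K M \<and>
    card (vertices K) = 6 * g - 2 * i + 1 \<and>
    fundamental_class K \<alpha> \<and>
    simplicial_map K torus7 f \<and>
    has_degree K \<alpha> torus7 torus7_class f d"
proof -
  define k where "k = g - i"
  have k: "k \<ge> 1" "g = k + 1 + (i - 1)" using assms by (auto simp: k_def)
  have V: "6 * g - 2 * i + 1 = 6 * k + 5 + 4 * (i - 1)" using k assms(2) by simp
  obtain K c f where st: "torus7_map K c f g (6 * g - 2 * i + 1) (int k)"
    using torus7_map_add_handles[OF k(1), of "i - 1"] unfolding V k(2)[symmetric] by blast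
  define \<epsilon> where "\<epsilon> = sgn d"
  have "d \<noteq> 0" using assms by auto
  then have \<epsilon>: "\<bar>\<epsilon>\<bar> = 1" by (simp add: \<epsilon>_def)
  have "\<bar>d\<bar> = int k" using assms by (simp add: k_def of_nat_diff)
  then have d: "d = \<epsilon> * int k" by (metis \<epsilon>_def sgn_mult_abs)
  let ?M = "top_of_set (geometric_carrier K)"
  have "closed_orientable_surface g ?M" "card (vertices K) = 6 * g - 2 * i + 1" "simplicial_map K torus7 f"
    and "finite_simplicial_complex K"
    using st by (simp_all add: torus7_map_def surface_complex_def)
  moreover from this have "triangulates K ?M"
    by (simp add: triangulates_def homeomorphic_space_refl)
  ultimately show ?thesis
    using has_degree_scaled[OF st \<epsilon>] unfolding d[symmetric] by blast
qed

end
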